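(* Let $(X_n)_{n\ge0}$ be the two-armed bandit algorithm with parameters $p_A,p_B$ and step sequence $(\gamma_n)_{n\ge1}$ (defined in the context), let $\Gamma_n=\gamma_1+\cdots+\gamma_n$. Assume that $0<p_B<p_A\le1$ and that $$\gamma_n=O\big(\Gamma_ne^{-p_B\Gamma_n}\big)\quad\text{and}\quad\sum_{n\ge1}\prod_{k=1}^n(1-p_A\gamma_k)<+\infty.$$ Then the two-armed bandit algorithm is a.s. infallible (i.e. $\mathbb{P}_x(X_n\to0)=0$ for every $x\in(0,1)$) and, for every $x\in(0,1)$, there exists an event $I_{\infty,x}$ of positive $\mathbb{P}_x$-probability on which $(X_n)$ is nondecreasing and $$e^{p_A\Gamma_n}(1-X_n)\longrightarrow\xi\in(0,+\infty)\quad\text{a.s. as }n\to+\infty,$$ where $\xi$ is a (random) positive finite limit. The assumption on the steps that $\gamma_n=O\big(\Gamma_ne^{-p_B\Gamma_n}\big)$ and $\sum_{n\ge1}\prod_{k=1}^n(1-p_A\gamma_k)<+\infty$ is fulfilled, for example, when $\gamma_n=\frac{C}{C+n}$ with $\frac1{p_A}<C\le\frac1{p_B}$.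
   Context: Two-armed bandit algorithm: let $(U_n)_{n\ge1}$ be i.i.d. random variables uniformly distributed on $[0,1]$, and let $(A_n)_{n\ge1},(B_n)_{n\ge1}$ be events such that $(\mathbf 1_{A_n},\mathbf 1_{B_n})_{n\ge1}$ is an i.i.d. sequence, independent of $(U_n)_{n\ge1}$, with $\mathbb{P}(A_1)=p_A$ and $\mathbb{P}(B_1)=p_B$. The steps satisfy $\gamma_n\in(0,1)$ for all $n\ge1$ and $\Gamma_n\to+\infty$. The algorithm starting from $x\in[0,1]$ is defined by $X_0=x$ and, for $n\ge0$, $$X_{n+1}=X_n+\gamma_{n+1}\big((1-X_n)\mathbf 1_{\{U_{n+1}\le X_n\}\cap A_{n+1}}-X_n\mathbf 1_{\{U_{n+1}>X_n\}\cap B_{n+1}}\big).$$ $\mathbb{P}_x$ denotes probability when $X_0=x$. *)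

theory Defs
  imports "HOL-Probability.Probability"
begin

text \<open>All sequences are indexed from 1 as in the mathematics; the entries at index 0 of
  \<open>\<gamma>\<close>, \<open>U\<close>, \<open>A\<close>, \<open>B\<close> are never used.\<close>

definition partial_steps :: "(nat \<Rightarrow> real) \<Rightarrow> nat \<Rightarrow> real" where
  "partial_steps \<gamma> n = (\<Sum>k=1..n. \<gamma> k)"

primrec bandit ::
  "(nat \<Rightarrow> real) \<Rightarrow> (nat \<Rightarrow> 'w \<Rightarrow> real) \<Rightarrow> (nat \<Rightarrow> 'w set) \<Rightarrow> (nat \<Rightarrow> 'w set) \<Rightarrow> real \<Rightarrow> nat \<Rightarrow> 'w \<Rightarrow> real"
where
  "bandit \<gamma> U A B x 0 = (\<lambda>\<omega>. x)"
| "bandit \<gamma> U A B x (Suc n) = (\<lambda>\<omega>. bandit \<gamma> U A B x n \<omega> + \<gamma> (Suc n) *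
     ((1 - bandit \<gamma> U A B x n \<omega>) *
        indicator ({\<omega>'. U (Suc n) \<omega>' \<le> bandit \<gamma> U A B x n \<omega>'} \<inter> A (Suc n)) \<omega>
      - bandit \<gamma> U A B x n \<omega> *
        indicator ({\<omega>'. U (Suc n) \<omega>' > bandit \<gamma> U A B x n \<omega>'} \<inter> B (Suc n)) \<omega>))"

definition arm_outcome :: "(nat \<Rightarrow> 'w set) \<Rightarrow> (nat \<Rightarrow> 'w set) \<Rightarrow> nat \<Rightarrow> 'w \<Rightarrow> real \<times> real" where
  "arm_outcome A B n \<omega> = (indicator (A n) \<omega>, indicator (B n) \<omega>)"

text \<open>\<open>A n\<close> and \<open>B n\<close> may depend on each other for the same \<open>n\<close>; only the pairs of indicators
  are independent over \<open>n\<close>. The process started at any \<open>x\<close> lives on the one space \<open>M\<close>, so the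
  probability given \<open>X\<^sub>0 = x\<close> is the measure of \<open>M\<close> applied to events about \<open>bandit \<gamma> U A B x\<close>.
  Independence of the two whole sequences is that of the \<open>\<sigma>\<close>-algebras they generate;
  \<open>indep_var\<close> does not apply because their value types differ.\<close>

locale two_armed_bandit = prob_space M
  for M :: "'w measure" +
  fixes U :: "nat \<Rightarrow> 'w \<Rightarrow> real"
    and A B :: "nat \<Rightarrow> 'w set"
    and p\<^sub>A p\<^sub>B :: real
    and \<gamma> :: "nat \<Rightarrow> real"
  assumes U_indep: "indep_vars (\<lambda>_. borel) U {1..}"
    and U_uniform: "\<And>n. n \<ge> 1 \<Longrightarrow> distr M borel (U n) = uniform_measure lborel {0..1}"
    and A_events: "\<And>n. n \<ge> 1 \<Longrightarrow> A n \<in> events"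
    and B_events: "\<And>n. n \<ge> 1 \<Longrightarrow> B n \<in> events"
    and arms_indep: "indep_vars (\<lambda>_. borel) (arm_outcome A B) {1..}"
    and arms_ident: "\<And>n. n \<ge> 1 \<Longrightarrow>
      distr M borel (arm_outcome A B n) = distr M borel (arm_outcome A B 1)"
    and arms_indep_U: "indep_set
      (sets (vimage_algebra (space M) (\<lambda>\<omega>. \<lambda>n\<in>{1..}. arm_outcome A B n \<omega>) (PiM {1..} (\<lambda>_. borel))))
      (sets (vimage_algebra (space M) (\<lambda>\<omega>. \<lambda>n\<in>{1..}. U n \<omega>) (PiM {1..} (\<lambda>_. borel))))"
    and prob_A: "prob (A 1) = p\<^sub>A"
    and prob_B: "prob (B 1) = p\<^sub>B"
    and steps: "\<And>n. n \<ge> 1 \<Longrightarrow> 0 < \<gamma> n \<and> \<gamma> n < 1"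
    and steps_diverge: "filterlim (partial_steps \<gamma>) at_top sequentially"
begin

lemma bandit_measurable [measurable]: "bandit \<gamma> U A B x n \<in> borel_measurable M"
proof (induction n)
  case 0
  then show ?case by simp
next
  case (Suc n)
  have U [measurable]: "U (Suc n) \<in> borel_measurable M"
    using U_indep unfolding indep_vars_def by auto
  have [measurable]: "A (Suc n) \<in> sets M" "B (Suc n) \<in> sets M"
    using A_events B_events by auto
  note Suc [measurable]
  have "bandit \<gamma> U A B x (Suc n) = (\<lambda>\<omega>. bandit \<gamma> U A B x n \<omega> + \<gamma> (Suc n) *
     ((1 - bandit \<gamma> U A B x n \<omega>) *
        (if U (Suc n) \<omega> \<le> bandit \<gamma> U A B x n \<omega> then indicator (A (Suc n)) \<omega> else 0)
      - bandit \<gamma> U A B x n \<omega> *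
        (if U (Suc n) \<omega> > bandit \<gamma> U A B x n \<omega> then indicator (B (Suc n)) \<omega> else 0)))"
    by (auto simp: fun_eq_iff indicator_def)
  also have "\<dots> \<in> borel_measurable M"
    by measurable
  finally show ?case .
qed

lemma fall_event: "{\<omega> \<in> space M. (\<lambda>n. bandit \<gamma> U A B x n \<omega>) \<longlonglongrightarrow> 0} \<in> events"
  by measurable

end

text \<open>By \<open>fall_event\<close> the set below is an event whenever \<open>two_armed_bandit\<close> holds.\<close>

definition infallible ::
  "'w measure \<Rightarrow> (nat \<Rightarrow> 'w \<Rightarrow> real) \<Rightarrow> (nat \<Rightarrow> 'w set) \<Rightarrow> (nat \<Rightarrow> 'w set) \<Rightarrow> (nat \<Rightarrow> real) \<Rightarrow> bool"
where
  "infallible M U A B \<gamma> \<longleftrightarrow> (\<forall>x\<in>{0<..<1}.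
     measure M {\<omega> \<in> space M. (\<lambda>n. bandit \<gamma> U A B x n \<omega>) \<longlonglongrightarrow> 0} = 0)"

definition step_condition :: "real \<Rightarrow> real \<Rightarrow> (nat \<Rightarrow> real) \<Rightarrow> bool" where
  "step_condition p\<^sub>A p\<^sub>B \<gamma> \<longleftrightarrow>
     \<gamma> \<in> O(\<lambda>n. partial_steps \<gamma> n * exp (- p\<^sub>B * partial_steps \<gamma> n)) \<and>
     summable (\<lambda>n. \<Prod>k=1..Suc n. 1 - p\<^sub>A * \<gamma> k)"

end

theory Submission
  imports Defs
begin

text \<open>
  Infallibility. Since \<open>p\<^sub>B < p\<^sub>A\<close>, the process \<open>exp (- \<lambda> X\<^sub>n)\<close> is a supermartingale as long as \<open>\<lambda>\<close> times
  every later step is small, so one may take \<open>\<lambda>\<^sub>n\<close> proportional to \<open>exp (p\<^sub>B \<Gamma>\<^sub>n) / \<Gamma>\<^sub>n\<close>, which increases.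
  The drift contributes a factor \<open>1 - a\<^sub>n\<close> with \<open>a\<^sub>n\<close> proportional to \<open>\<gamma>\<^bsub>n+1\<^esub> \<lambda>\<^sub>n X\<^sub>n (1 - X\<^sub>n)\<close>, whence
  \<open>E[(1 + a\<^sub>1 + \<dots> + a\<^bsub>n-1\<^esub>) exp (- \<lambda>\<^sub>n X\<^sub>m)] \<le> 1\<close> for \<open>m \<ge> n\<close>. Letting \<open>m\<close> and then \<open>n\<close> tend to infinity,
  \<open>a\<^sub>1 + a\<^sub>2 + \<dots>\<close> converges a.s. on the event \<open>X\<^sub>n \<rightarrow> 0\<close>. But
  \<open>X\<^sub>n \<ge> x \<Prod>(1 - \<gamma>\<^sub>k 1\<^sub>B)\<close>, which is of order \<open>exp (- p\<^sub>B \<Gamma>\<^sub>n)\<close> by Kolmogorov's one-series theorem, so on this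
  event \<open>a\<^sub>n\<close> dominates a multiple of \<open>\<gamma>\<^bsub>n+1\<^esub> / \<Gamma>\<^sub>n\<close>, whose sum diverges.

  Fast convergence. If arm \<open>A\<close> is always chosen, \<open>1 - X\<^sub>n = (1 - x) \<Prod>(1 - \<gamma>\<^sub>k 1\<^sub>A)\<close>, and this is of order
  \<open>exp (- p\<^sub>A \<Gamma>\<^sub>n)\<close>. The probability that \<open>U\<^bsub>n+1\<^esub>\<close> first exceeds this run at some \<open>n \<ge> N\<close> is at most a tail of
  the assumed convergent series, and up to \<open>N\<close> it suffices that all \<open>U\<^sub>k \<le> x\<close>, an independent event.
\<close>

section \<open>Sigma-algebras of subfamilies and averaging out an independent coordinate\<close>

section \<open>Independence along a family of random variables\<close>

text \<open>Packaged as a \<open>measure\<close> so that \<open>borel_measurable\<close> can express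
  dependence on the variables indexed by \<open>K\<close> alone; this plays the part of a
  filtration.\<close>

definition family_algebra :: "'w measure \<Rightarrow> ('i \<Rightarrow> 'w \<Rightarrow> 'a::topological_space) \<Rightarrow> 'i set \<Rightarrow> 'w measure"
  where "family_algebra M X K =
    sigma (space M) (\<Union>i\<in>K. {X i -` S \<inter> space M | S. S \<in> sets borel})"

lemma space_family_algebra [simp]: "space (family_algebra M X K) = space M"
  unfolding family_algebra_def by (rule space_measure_of) auto

lemma sets_family_algebra:
  "sets (family_algebra M X K) =
    sigma_sets (space M) (\<Union>i\<in>K. {X i -` S \<inter> space M | S. S \<in> sets borel})"
  unfolding family_algebra_def by (rule sets_measure_of) auto

lemma measurable_family_algebra:
  assumes "i \<in> K" shows "X i \<in> borel_measurable (family_algebra M X K)"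
  using assms by (auto simp: measurable_def sets_family_algebra)

lemma family_algebra_mono:
  assumes "K \<subseteq> L" shows "sets (family_algebra M X K) \<subseteq> sets (family_algebra M X L)"
  unfolding sets_family_algebra using assms by (intro sigma_sets_mono') auto

lemma measurable_family_algebra_mono:
  assumes "f \<in> measurable (family_algebra M X K) N" "K \<subseteq> L"
  shows "f \<in> measurable (family_algebra M X L) N"
  using assms family_algebra_mono[OF assms(2), of M X] by (auto simp: measurable_def)

lemma measurable_family_algebra_subalgebra:
  assumes "f \<in> measurable (family_algebra M X K) N"
    and "\<And>i. i \<in> K \<Longrightarrow> X i \<in> borel_measurable M"
  shows "f \<in> measurable M N"
proof -
  have "sets (family_algebra M X K) \<subseteq> sets M"
    unfolding sets_family_algebra using measurable_sets[OF assms(2)]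
    by (intro sets.sigma_sets_subset) auto
  then show ?thesis using assms(1) by (auto simp: measurable_def)
qed

context prob_space begin

text \<open>Preimages of Borel sets under a single \<open>X i\<close> form an intersection-stable
  generator, so independence of the family passes to the sigma-algebras of disjoint blocks, and from
  there to whatever is measurable over them.\<close>

lemma indep_var_family_algebra:
  assumes indep: "indep_vars (\<lambda>_. borel) X I" and KL: "K \<subseteq> I" "L \<subseteq> I" "K \<inter> L = {}"
    and f: "f \<in> measurable (family_algebra M X K) S"
    and g: "g \<in> measurable (family_algebra M X L) T"
  shows "indep_var S f T g"
proof -
  have rv: "X i \<in> borel_measurable M" if "i \<in> I" for i
    using indep that by (auto simp: indep_vars_def)
  let ?E = "\<lambda>i. {X i -` S \<inter> space M | S. S \<in> sets borel}"
  have "indep_sets (\<lambda>j. sigma_sets (space M) (\<Union>i\<in>case_bool K L j. ?E i)) UNIV"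
  proof (rule indep_sets_collect_sigma)
    show "indep_sets ?E (\<Union>j\<in>UNIV. case_bool K L j)"
      using indep KL unfolding indep_vars_def2
      by (auto simp: UNIV_bool intro: indep_sets_mono_index)
    show "disjoint_family_on (case_bool K L) UNIV"
      using KL by (auto simp: disjoint_family_on_def split: bool.splits)
    show "Int_stable (?E i)" for i
    proof (rule Int_stableI)
      fix a b assume "a \<in> ?E i" "b \<in> ?E i"
      then obtain S T where "a = X i -` S \<inter> space M" "S \<in> sets borel"
        "b = X i -` T \<inter> space M" "T \<in> sets borel" by auto
      then have "a \<inter> b = X i -` (S \<inter> T) \<inter> space M" "S \<inter> T \<in> sets borel" by auto
      then show "a \<inter> b \<in> ?E i" by blast
    qed
  qed
  moreover have "(\<lambda>j. sigma_sets (space M) (\<Union>i\<in>case_bool K L j. ?E i)) =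
      case_bool (sets (family_algebra M X K)) (sets (family_algebra M X L))"
    unfolding sets_family_algebra by (rule ext) (simp split: bool.split)
  ultimately have "indep_set (sets (family_algebra M X K)) (sets (family_algebra M X L))"
    unfolding indep_set_def by (simp only:)
  then have "indep_set (sigma_sets (space M) {f -` A \<inter> space M | A. A \<in> sets S})
      (sigma_sets (space M) {g -` A \<inter> space M | A. A \<in> sets T})"
    unfolding indep_set_def
  proof (rule indep_sets_mono_sets)
    fix j :: bool
    have "sigma_sets (space M) {f -` A \<inter> space M | A. A \<in> sets S} \<subseteq> sets (family_algebra M X K)"
      using measurable_sets[OF f]
      by (intro sets.sigma_sets_subset[where M="family_algebra M X K", simplified]) auto
    moreover have "sigma_sets (space M) {g -` A \<inter> space M | A. A \<in> sets T} \<subseteq> sets (family_algebra M X L)"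
      using measurable_sets[OF g]
      by (intro sets.sigma_sets_subset[where M="family_algebra M X L", simplified]) auto
    ultimately show "case_bool (sigma_sets (space M) {f -` A \<inter> space M | A. A \<in> sets S})
      (sigma_sets (space M) {g -` A \<inter> space M | A. A \<in> sets T}) j
       \<subseteq> case_bool (sets (family_algebra M X K)) (sets (family_algebra M X L)) j"
      by (auto split: bool.splits)
  qed
  moreover have "f \<in> measurable M S" "g \<in> measurable M T"
    using measurable_family_algebra_subalgebra[OF f] measurable_family_algebra_subalgebra[OF g] KL rv
    by blast+
  ultimately show ?thesis unfolding indep_var_eq by (intro conjI)
qed

text \<open>Fubini for the product law of (f, g) and V: with the past frozen, the probability that V
  lies below the level g is its distribution function at g.\<close>

lemma expectation_threshold:
  fixes f g V :: "'a \<Rightarrow> real"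
  assumes indep: "indep_vars (\<lambda>_. borel) X I" and K: "K \<subseteq> I" "i \<in> I" "i \<notin> K"
    and f [measurable]: "f \<in> borel_measurable (family_algebra M X K)" and fb: "\<And>\<omega>. \<bar>f \<omega>\<bar> \<le> c"
    and g [measurable]: "g \<in> borel_measurable (family_algebra M X K)"
    and V: "V = (\<lambda>\<omega>. h (X i \<omega>))" and h [measurable]: "h \<in> borel_measurable borel"
  shows "(\<integral>\<omega>. f \<omega> * indicator {\<omega>. V \<omega> \<le> g \<omega>} \<omega> \<partial>M)
    = (\<integral>\<omega>. f \<omega> * measure (distr M borel V) {..g \<omega>} \<partial>M)"
proof -
  have [measurable]: "X i \<in> borel_measurable (family_algebra M X {i})"
    by (rule measurable_family_algebra) simp
  have V': "V \<in> borel_measurable (family_algebra M X {i})" unfolding V by measurable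
  \<comment> \<open>\<open>V\<close> is padded by 0 because \<open>indep_var\<close> wants one value
    type for both variables, here pairs of reals.\<close>
  have "indep_var (borel \<Otimes>\<^sub>M borel) (\<lambda>\<omega>. (f \<omega>, g \<omega>)) (borel \<Otimes>\<^sub>M borel) (\<lambda>\<omega>. (V \<omega>, 0))"
    by (rule indep_var_family_algebra[OF indep, of K "{i}"]) (use K V' in auto)
  then have rv [measurable]: "(\<lambda>\<omega>. (f \<omega>, g \<omega>)) \<in> measurable M (borel \<Otimes>\<^sub>M borel)"
      "(\<lambda>\<omega>. (V \<omega>, 0)) \<in> measurable M (borel \<Otimes>\<^sub>M (borel :: real measure))"
    and eq: "distr M (borel \<Otimes>\<^sub>M borel) (\<lambda>\<omega>. (f \<omega>, g \<omega>)) \<Otimes>\<^sub>M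
        distr M (borel \<Otimes>\<^sub>M borel) (\<lambda>\<omega>. (V \<omega>, 0 :: real))
      = distr M ((borel \<Otimes>\<^sub>M borel) \<Otimes>\<^sub>M (borel \<Otimes>\<^sub>M borel)) (\<lambda>\<omega>. ((f \<omega>, g \<omega>), (V \<omega>, 0)))"
    unfolding indep_var_distribution_eq by auto
  have [measurable]: "V \<in> borel_measurable M"
    using measurable_compose[OF rv(2) measurable_fst] by simp
  let ?P = "distr M (borel \<Otimes>\<^sub>M borel) (\<lambda>\<omega>. (f \<omega>, g \<omega>))"
  let ?Q = "distr M (borel \<Otimes>\<^sub>M borel) (\<lambda>\<omega>. (V \<omega>, 0 :: real))"
  let ?D = "distr M borel V"
  interpret P: prob_space ?P by (rule prob_space_distr) measurable
  interpret Q: prob_space ?Q by (rule prob_space_distr) measurable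
  interpret PQ: pair_prob_space ?P ?Q ..
  have c: "0 \<le> c" using fb[of undefined] by linarith
  \<comment> \<open>Clipping to [-c, c] makes the integrand bounded on the whole product space; by
    \<open>fb\<close> it changes nothing along \<open>f\<close>.\<close>
  let ?F = "\<lambda>(p :: real \<times> real, v :: real \<times> real). max (-c) (min c (fst p)) * indicator {..snd p} (fst v)"
  have F [measurable]: "?F \<in> borel_measurable ((borel \<Otimes>\<^sub>M borel) \<Otimes>\<^sub>M (borel \<Otimes>\<^sub>M borel))"
  proof -
    have "?F = (\<lambda>z. max (-c) (min c (fst (fst z))) * (if fst (snd z) \<le> snd (fst z) then 1 else 0))"
      by (auto simp: fun_eq_iff indicator_def)
    also have "\<dots> \<in> borel_measurable ((borel \<Otimes>\<^sub>M borel) \<Otimes>\<^sub>M (borel \<Otimes>\<^sub>M borel))" by measurable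
    finally show ?thesis .
  qed
  have Fi: "integrable (?P \<Otimes>\<^sub>M ?Q) ?F"
    by (rule PQ.P.integrable_const_bound[where B=c])
       (use c in \<open>auto simp: indicator_def abs_le_iff split: prod.splits\<close>)
  have fc: "max (-c) (min c (f \<omega>)) = f \<omega>" for \<omega> using fb[of \<omega>] by auto
  have meas: "(\<integral>v. indicator {..t} (fst v) \<partial>?Q) = measure ?D {..t}" for t
  proof -
    have "(\<integral>v. indicator {..t} (fst v) \<partial>?Q) = (\<integral>\<omega>. indicator {..t} (V \<omega>) \<partial>M :: real)"
      by (subst integral_distr) auto
    also have "\<dots> = (\<integral>v. indicator {..t} v \<partial>?D)"
      by (subst integral_distr) auto
    finally show ?thesis by simp
  qed
  have "(\<integral>\<omega>. f \<omega> * indicator {\<omega>. V \<omega> \<le> g \<omega>} \<omega> \<partial>M) = (\<integral>\<omega>. ?F ((f \<omega>, g \<omega>), (V \<omega>, 0)) \<partial>M)"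
    by (intro Bochner_Integration.integral_cong) (auto simp: fc indicator_def)
  also have "\<dots> = (\<integral>z. ?F z \<partial>distr M ((borel \<Otimes>\<^sub>M borel) \<Otimes>\<^sub>M (borel \<Otimes>\<^sub>M borel)) (\<lambda>\<omega>. ((f \<omega>, g \<omega>), (V \<omega>, 0))))"
    by (subst integral_distr) auto
  also have "\<dots> = (\<integral>z. ?F z \<partial>(?P \<Otimes>\<^sub>M ?Q))" unfolding eq ..
  also have "\<dots> = (\<integral>p. \<integral>v. ?F (p, v) \<partial>?Q \<partial>?P)"
    using PQ.integral_fst'[OF Fi] by simp
  also have "\<dots> = (\<integral>p. max (-c) (min c (fst p)) * measure ?D {..snd p} \<partial>?P)"
    by (intro Bochner_Integration.integral_cong) (auto simp: meas)
  also have "\<dots> = (\<integral>\<omega>. f \<omega> * measure ?D {..g \<omega>} \<partial>M)"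
  proof -
    interpret D: prob_space ?D by (rule prob_space_distr) measurable
    have [measurable]: "(\<lambda>p. measure ?D {..snd p}) \<in> borel_measurable (borel \<Otimes>\<^sub>M borel)"
    proof -
      \<comment> \<open>A distribution function is monotone, hence Borel.\<close>
      have [measurable]: "(\<lambda>t. measure ?D {..t}) \<in> borel_measurable borel"
        by (rule borel_measurable_mono) (auto simp: mono_def intro!: D.finite_measure_mono)
      show ?thesis by measurable
    qed
    show ?thesis by (subst integral_distr) (auto simp: fc)
  qed
  finally show ?thesis .
qed

end

section \<open>Almost sure convergence of centred independent series, via stopped sums\<close>

section \<open>Kolmogorov's one-series theorem\<close>

text \<open>The partial sum stopped when its modulus first reaches \<epsilon>: once there, the value
  never changes again.\<close>

primrec stopped_sum :: "real \<Rightarrow> (nat \<Rightarrow> 'w \<Rightarrow> real) \<Rightarrow> nat \<Rightarrow> 'w \<Rightarrow> real" where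
  "stopped_sum \<epsilon> X 0 = (\<lambda>\<omega>. 0)"
| "stopped_sum \<epsilon> X (Suc n) = (\<lambda>\<omega>. stopped_sum \<epsilon> X n \<omega> +
     (if \<bar>stopped_sum \<epsilon> X n \<omega>\<bar> < \<epsilon> then X n \<omega> else 0))"

lemma stopped_sum_measurable:
  "stopped_sum \<epsilon> X n \<in> borel_measurable (family_algebra M X {..<n})"
proof (induction n)
  case (Suc n)
  have step: "(\<lambda>\<omega>. f \<omega> + (if \<bar>f \<omega>\<bar> < \<epsilon> then g \<omega> else 0)) \<in> borel_measurable N"
    if [measurable]: "f \<in> borel_measurable N" "g \<in> borel_measurable N" for f g :: "'a \<Rightarrow> real" and N
    by measurable
  show ?case unfolding stopped_sum.simps
    by (rule step[OF measurable_family_algebra_mono[OF Suc] measurable_family_algebra])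
      (auto simp: lessThan_Suc)
next
  case 0
  show ?case by (simp only: stopped_sum.simps) (rule borel_measurable_const)
qed

text \<open>Freezing is permanent, so a value still below \<epsilon> at time n means that no partial
  sum up to n has reached \<epsilon>. By contraposition the single variable at time n detects the
  maximum over all k \<le> n.\<close>

lemma stopped_sum_eq_sum:
  assumes "\<bar>stopped_sum \<epsilon> X n \<omega>\<bar> < \<epsilon>" "k \<le> n"
  shows "stopped_sum \<epsilon> X k \<omega> = (\<Sum>i<k. X i \<omega>) \<and> \<bar>\<Sum>i<k. X i \<omega>\<bar> < \<epsilon>"
  using assms
proof (induction n arbitrary: k)
  case (Suc n)
  have n: "\<bar>stopped_sum \<epsilon> X n \<omega>\<bar> < \<epsilon>"
    using Suc.prems(1) by (cases "\<bar>stopped_sum \<epsilon> X n \<omega>\<bar> < \<epsilon>") simp_all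
  show ?case
  proof (cases "k = Suc n")
    case True
    have "stopped_sum \<epsilon> X k \<omega> = (\<Sum>i<k. X i \<omega>)"
      using Suc.IH[OF n order_refl] n True by simp
    then show ?thesis using Suc.prems(1) True by metis
  next
    case False
    then show ?thesis using Suc.IH[OF n, of k] Suc.prems(2) by linarith
  qed
qed simp

context prob_space begin

text \<open>Injectivity makes the singleton blocks {f j} disjoint, and \<open>X (f j)\<close> is a
  coordinate of its block.\<close>

lemma indep_vars_reindex:
  assumes "indep_vars (\<lambda>_. N) X I" "inj_on f J" "f ` J \<subseteq> I"
  shows "indep_vars (\<lambda>_. N) (\<lambda>j. X (f j)) J"
proof -
  have "indep_vars (\<lambda>j. PiM {f j} (\<lambda>_. N)) (\<lambda>j \<omega>. restrict (\<lambda>i. X i \<omega>) {f j}) J"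
    by (rule indep_vars_restrict[OF assms(1)])
       (use assms in \<open>auto simp: disjoint_family_on_def inj_on_def\<close>)
  then have "indep_vars (\<lambda>_. N) (\<lambda>j \<omega>. (\<lambda>x. x (f j)) (restrict (\<lambda>i. X i \<omega>) {f j})) J"
    by (rule indep_vars_compose2) (rule measurable_component_singleton, simp)
  then show ?thesis by simp
qed

text \<open>The increment is \<open>X n\<close> times an indicator determined by the earlier
  variables. Hence the cross term has mean 0 by independence, and the squared increment is at most
  the square of \<open>X n\<close>.\<close>

lemma stopped_sum_second_moment:
  fixes X :: "nat \<Rightarrow> 'a \<Rightarrow> real"
  assumes indep: "indep_vars (\<lambda>_. borel) X UNIV"
    and sq: "\<And>i. integrable M (\<lambda>\<omega>. (X i \<omega>)\<^sup>2)" and mean: "\<And>i. expectation (X i) = 0"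
  shows "integrable M (\<lambda>\<omega>. (stopped_sum \<epsilon> X n \<omega>)\<^sup>2) \<and>
    expectation (\<lambda>\<omega>. (stopped_sum \<epsilon> X n \<omega>)\<^sup>2) \<le> (\<Sum>i<n. expectation (\<lambda>\<omega>. (X i \<omega>)\<^sup>2))"
proof (induction n)
  case (Suc n)
  let ?T = "stopped_sum \<epsilon> X n"
  \<comment> \<open>The stopped sum on the event of not having stopped yet. There it is bounded by
    \<epsilon>, so \<open>?D\<close> is integrable.\<close>
  let ?D = "\<lambda>\<omega>. if \<bar>?T \<omega>\<bar> < \<epsilon> then ?T \<omega> else 0"
  let ?Y = "\<lambda>\<omega>. if \<bar>?T \<omega>\<bar> < \<epsilon> then (X n \<omega>)\<^sup>2 else 0"
  have X [measurable]: "X i \<in> borel_measurable M" for i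
    using indep by (auto simp: indep_vars_def)
  have [measurable]: "?T \<in> borel_measurable (family_algebra M X {..<n})"
    by (rule stopped_sum_measurable)
  have [measurable]: "?T \<in> borel_measurable M"
    by (rule measurable_family_algebra_subalgebra[OF stopped_sum_measurable]) simp
  have D: "indep_var borel ?D borel (X n)"
    by (rule indep_var_family_algebra[OF indep, of "{..<n}" "{n}"])
       (auto intro: measurable_family_algebra)
  have Xi: "integrable M (X n)"
    by (rule square_integrable_imp_integrable[OF _ sq]) simp
  have Di: "integrable M ?D"
    by (rule integrable_const_bound[where B="\<bar>\<epsilon>\<bar>"]) auto
  have Yi: "integrable M ?Y"
    by (rule Bochner_Integration.integrable_bound[OF sq[of n]]) auto
  have DX: "integrable M (\<lambda>\<omega>. ?D \<omega> * X n \<omega>)" "expectation (\<lambda>\<omega>. ?D \<omega> * X n \<omega>) = 0"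
    using indep_var_integrable[OF D Di Xi] indep_var_lebesgue_integral[OF D Di Xi] mean by auto
  have eq: "(\<lambda>\<omega>. (stopped_sum \<epsilon> X (Suc n) \<omega>)\<^sup>2) = (\<lambda>\<omega>. (?T \<omega>)\<^sup>2 + 2 * (?D \<omega> * X n \<omega>) + ?Y \<omega>)"
    by (auto simp: fun_eq_iff power2_sum)
  have "expectation ?Y \<le> expectation (\<lambda>\<omega>. (X n \<omega>)\<^sup>2)"
    by (rule integral_mono[OF Yi sq]) auto
  then have "expectation (\<lambda>\<omega>. (?T \<omega>)\<^sup>2 + 2 * (?D \<omega> * X n \<omega>) + ?Y \<omega>)
      \<le> (\<Sum>i<Suc n. expectation (\<lambda>\<omega>. (X i \<omega>)\<^sup>2))"
    using Suc DX Yi by simp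
  then show ?case unfolding eq using Suc DX(1) Yi by (intro conjI) auto
qed simp

text \<open>Chebyshev for the stopped sum, whose modulus at time n is at least \<epsilon> as soon as
  some partial sum up to n reaches \<epsilon>.\<close>

lemma Kolmogorov_maximal_inequality:
  fixes X :: "nat \<Rightarrow> 'a \<Rightarrow> real"
  assumes indep: "indep_vars (\<lambda>_. borel) X UNIV"
    and sq: "\<And>i. integrable M (\<lambda>\<omega>. (X i \<omega>)\<^sup>2)" and mean: "\<And>i. expectation (X i) = 0"
    and e: "0 < \<epsilon>"
  shows "prob {\<omega>\<in>space M. \<exists>k\<le>n. \<epsilon> \<le> \<bar>\<Sum>i<k. X i \<omega>\<bar>} \<le> (\<Sum>i<n. expectation (\<lambda>\<omega>. (X i \<omega>)\<^sup>2)) / \<epsilon>\<^sup>2"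
proof -
  have X [measurable]: "X i \<in> borel_measurable M" for i
    using indep by (auto simp: indep_vars_def)
  let ?T = "stopped_sum \<epsilon> X n"
  have [measurable]: "?T \<in> borel_measurable M"
    by (rule measurable_family_algebra_subalgebra[OF stopped_sum_measurable]) simp
  have "prob {\<omega>\<in>space M. \<exists>k\<le>n. \<epsilon> \<le> \<bar>\<Sum>i<k. X i \<omega>\<bar>} \<le> prob {\<omega>\<in>space M. \<epsilon>\<^sup>2 \<le> (?T \<omega>)\<^sup>2}"
  proof (rule finite_measure_mono)
    show "{\<omega>\<in>space M. \<exists>k\<le>n. \<epsilon> \<le> \<bar>\<Sum>i<k. X i \<omega>\<bar>} \<subseteq> {\<omega>\<in>space M. \<epsilon>\<^sup>2 \<le> (?T \<omega>)\<^sup>2}"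
    proof safe
      fix \<omega> k assume "k \<le> n" "\<epsilon> \<le> \<bar>\<Sum>i<k. X i \<omega>\<bar>"
      then have "\<epsilon> \<le> \<bar>?T \<omega>\<bar>" using stopped_sum_eq_sum[of \<epsilon> X n \<omega> k] by linarith
      then show "\<epsilon>\<^sup>2 \<le> (?T \<omega>)\<^sup>2" using e by (metis abs_le_square_iff abs_of_pos)
    qed
  qed measurable
  also have "\<dots> \<le> expectation (\<lambda>\<omega>. (?T \<omega>)\<^sup>2) / \<epsilon>\<^sup>2"
    by (rule integral_Markov_inequality_measure[where A="{}"])
       (use stopped_sum_second_moment[OF indep sq mean] e in auto)
  also have "\<dots> \<le> (\<Sum>i<n. expectation (\<lambda>\<omega>. (X i \<omega>)\<^sup>2)) / \<epsilon>\<^sup>2"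
    using stopped_sum_second_moment[OF indep sq mean] e by (intro divide_right_mono) auto
  finally show ?thesis .
qed

text \<open>The maximal inequality bounds the oscillation after time m by a tail of the variance
  series, so the partial sums are almost surely Cauchy.\<close>

lemma Kolmogorov_one_series:
  fixes X :: "nat \<Rightarrow> 'a \<Rightarrow> real"
  assumes indep: "indep_vars (\<lambda>_. borel) X UNIV"
    and sq: "\<And>i. integrable M (\<lambda>\<omega>. (X i \<omega>)\<^sup>2)" and mean: "\<And>i. expectation (X i) = 0"
    and summ: "summable (\<lambda>i. expectation (\<lambda>\<omega>. (X i \<omega>)\<^sup>2))"
  shows "AE \<omega> in M. summable (\<lambda>i. X i \<omega>)"
proof -
  have X [measurable]: "X i \<in> borel_measurable M" for i
    using indep by (auto simp: indep_vars_def)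
  let ?v = "\<lambda>i. expectation (\<lambda>\<omega>. (X i \<omega>)\<^sup>2)"
  have v0: "0 \<le> ?v i" for i by simp
  have tail: "prob {\<omega>\<in>space M. \<exists>k. \<epsilon> \<le> \<bar>\<Sum>i<k. X (i + m) \<omega>\<bar>} \<le> (\<Sum>i. ?v (i + m)) / \<epsilon>\<^sup>2"
    if e: "0 < \<epsilon>" for \<epsilon> m
  proof -
    let ?E = "\<lambda>n. {\<omega>\<in>space M. \<exists>k\<le>n. \<epsilon> \<le> \<bar>\<Sum>i<k. X (i + m) \<omega>\<bar>}"
    have indep': "indep_vars (\<lambda>_. borel) (\<lambda>i. X (i + m)) UNIV"
      by (rule indep_vars_reindex[OF indep]) auto
    have summ': "summable (\<lambda>i. ?v (i + m))" using summ by (rule summable_ignore_initial_segment)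
    have le: "prob (?E n) \<le> (\<Sum>i. ?v (i + m)) / \<epsilon>\<^sup>2" for n
    proof -
      have "prob (?E n) \<le> (\<Sum>i<n. ?v (i + m)) / \<epsilon>\<^sup>2"
        by (rule Kolmogorov_maximal_inequality[OF indep' sq mean e])
      also have "\<dots> \<le> (\<Sum>i. ?v (i + m)) / \<epsilon>\<^sup>2"
        by (intro divide_right_mono sum_le_suminf summ') auto
      finally show ?thesis .
    qed
    \<comment> \<open>As the horizon n grows, the events \<open>?E n\<close> increase to the one
      with unrestricted k.\<close>
    have "(\<lambda>n. prob (?E n)) \<longlonglongrightarrow> prob (\<Union>n. ?E n)"
      by (rule finite_Lim_measure_incseq) (auto simp: incseq_def, meson order_trans)
    moreover have "(\<Union>n. ?E n) = {\<omega>\<in>space M. \<exists>k. \<epsilon> \<le> \<bar>\<Sum>i<k. X (i + m) \<omega>\<bar>}" by auto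
    ultimately show ?thesis using le by (auto intro: LIMSEQ_le_const2)
  qed
  have ex: "AE \<omega> in M. \<exists>m. \<forall>k. \<bar>\<Sum>i<k. X (i + m) \<omega>\<bar> < \<epsilon>" if e: "0 < \<epsilon>" for \<epsilon>
  proof -
    \<comment> \<open>\<open>?N\<close> lies in the exceptional event of every starting point m, and
      the bounds for these tend to 0.\<close>
    let ?N = "{\<omega>\<in>space M. \<forall>m. \<exists>k. \<epsilon> \<le> \<bar>\<Sum>i<k. X (i + m) \<omega>\<bar>}"
    have "(\<lambda>m. (\<Sum>i. ?v (i + m)) / \<epsilon>\<^sup>2) \<longlonglongrightarrow> 0 / \<epsilon>\<^sup>2"
      by (intro tendsto_divide tendsto_const suminf_exist_split2 summ) (use e in auto)
    moreover have "prob ?N \<le> (\<Sum>i. ?v (i + m)) / \<epsilon>\<^sup>2" for m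
      by (rule order_trans[OF finite_measure_mono tail[OF e, of m]]) auto
    ultimately have "prob ?N \<le> 0" by (auto intro: LIMSEQ_le_const)
    then have "prob ?N = 0" using measure_nonneg[of M ?N] by linarith
    then have "?N \<in> null_sets M" by (simp add: null_sets_def emeasure_eq_measure)
    then show ?thesis
      by (rule AE_I'[of ?N]) (auto simp: not_less)
  qed
  have "AE \<omega> in M. \<forall>j. \<exists>m. \<forall>k. \<bar>\<Sum>i<k. X (i + m) \<omega>\<bar> < 1 / real (Suc j)"
    unfolding AE_all_countable using ex by simp
  then show ?thesis
  proof eventually_elim
    case (elim \<omega>)
    show ?case unfolding summable_Cauchy
    proof (intro allI impI)
      fix e :: real assume "0 < e"
      then obtain j where j: "1 / real (Suc j) < e / 2"
        using nat_approx_posE[of "e / 2"] by auto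
      obtain m where m: "\<And>k. \<bar>\<Sum>i<k. X (i + m) \<omega>\<bar> < 1 / real (Suc j)" using elim by blast
      have "norm (\<Sum>i\<in>{a..<b}. X i \<omega>) < e" if "m \<le> a" for a b
      proof (cases "a \<le> b")
        case True
        have shift: "(\<Sum>i<k. X (i + m) \<omega>) = (\<Sum>i\<in>{m..<m + k}. X i \<omega>)" for k
          using sum.shift_bounds_nat_ivl[of "\<lambda>i. X i \<omega>" 0 m k] by (simp add: atLeast0LessThan add.commute)
        \<comment> \<open>Both ends are compared with the sum started at m, each at a cost below e /
          2.\<close>
        have "(\<Sum>i\<in>{a..<b}. X i \<omega>) = (\<Sum>i<b - m. X (i + m) \<omega>) - (\<Sum>i<a - m. X (i + m) \<omega>)"
          unfolding shift using True that sum.atLeastLessThan_concat[of m a b "\<lambda>i. X i \<omega>"] by simp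
        then show ?thesis using m[of "b - m"] m[of "a - m"] j unfolding real_norm_def by linarith
      qed (use \<open>0 < e\<close> in simp)
      then show "\<exists>N. \<forall>a\<ge>N. \<forall>b. norm (\<Sum>i\<in>{a..<b}. X i \<omega>) < e" by blast
    qed
  qed
qed

end

section \<open>Deterministic estimates for the steps and their partial sums\<close>

section \<open>Step sequences\<close>

lemma partial_steps_0 [simp]: "partial_steps \<gamma> 0 = 0"
  by (simp add: partial_steps_def)

lemma partial_steps_Suc [simp]: "partial_steps \<gamma> (Suc n) = partial_steps \<gamma> n + \<gamma> (Suc n)"
  by (simp add: partial_steps_def)

lemma partial_steps_eq_sum: "partial_steps \<gamma> n = (\<Sum>k<n. \<gamma> (Suc k))"
  by (induction n) auto

lemma partial_steps_mono:
  assumes "\<And>k. 0 \<le> \<gamma> (Suc k)" "m \<le> n"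
  shows "partial_steps \<gamma> m \<le> partial_steps \<gamma> n"
  unfolding partial_steps_eq_sum using assms by (intro sum_mono2) auto

text \<open>A lower Riemann sum for the integral of exp (- q s) over the mesh \<Gamma>_k: each term,
  taken at the right end point, is at most the integral over its interval, and these integrals
  telescope.\<close>

lemma summable_step_exp:
  assumes \<gamma>: "\<And>k. 0 \<le> \<gamma> (Suc k)" and q: "0 < q"
  shows "summable (\<lambda>k. \<gamma> (Suc k) * exp (- q * partial_steps \<gamma> (Suc k)))"
proof (rule summableI_nonneg_bounded)
  let ?e = "\<lambda>n. exp (- q * partial_steps \<gamma> n)"
  show "0 \<le> \<gamma> (Suc k) * ?e (Suc k)" for k using \<gamma> by simp
  have step: "\<gamma> (Suc k) * ?e (Suc k) \<le> (?e k - ?e (Suc k)) / q" for k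
  proof -
    have "?e k = ?e (Suc k) * exp (q * \<gamma> (Suc k))"
      by (simp add: exp_add[symmetric] algebra_simps)
    moreover have "?e (Suc k) * (1 + q * \<gamma> (Suc k)) \<le> ?e (Suc k) * exp (q * \<gamma> (Suc k))"
      by (intro mult_left_mono exp_ge_add_one_self) auto
    ultimately show ?thesis using q by (simp add: field_simps)
  qed
  show "(\<Sum>k<n. \<gamma> (Suc k) * ?e (Suc k)) \<le> 1 / q" for n
  proof -
    have "(\<Sum>k<n. \<gamma> (Suc k) * ?e (Suc k)) \<le> (\<Sum>k<n. (?e k - ?e (Suc k)) / q)"
      by (intro sum_mono step)
    also have "\<dots> = (?e 0 - ?e n) / q"
      using sum_lessThan_telescope'[of ?e n] by (simp only: sum_divide_distrib[symmetric])
    also have "\<dots> \<le> 1 / q" using q by (intro divide_right_mono) auto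
    finally show ?thesis .
  qed
qed

text \<open>One factor \<gamma> is bounded by a multiple of \<Gamma> exp (- p \<Gamma>), where half
  of the exponential absorbs \<Gamma>. The other factor stays as the mesh width in
  \<open>summable_step_exp\<close> with q = p / 2.\<close>

lemma summable_step_squares:
  assumes \<gamma>: "\<And>k. 0 \<le> \<gamma> (Suc k)" and p: "0 < p"
    and O: "\<gamma> \<in> O(\<lambda>n. partial_steps \<gamma> n * exp (- p * partial_steps \<gamma> n))"
  shows "summable (\<lambda>k. (\<gamma> (Suc k))\<^sup>2)"
proof -
  have \<Gamma>: "0 \<le> partial_steps \<gamma> n" for n
    using partial_steps_mono[of \<gamma> 0 n] \<gamma> by simp
  from O obtain c where c: "0 < c"
    and ev: "eventually (\<lambda>n. norm (\<gamma> n) \<le> c * norm (partial_steps \<gamma> n * exp (- p * partial_steps \<gamma> n))) sequentially"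
    by (auto elim!: landau_o.bigE)
  have "eventually (\<lambda>k. norm ((\<gamma> (Suc k))\<^sup>2)
      \<le> c * (2 / p) * (\<gamma> (Suc k) * exp (- (p / 2) * partial_steps \<gamma> (Suc k)))) sequentially"
    using ev[unfolded eventually_sequentially_Suc[of "\<lambda>n. norm (\<gamma> n) \<le> c * norm (partial_steps \<gamma> n * exp (- p * partial_steps \<gamma> n))", symmetric]]
  proof eventually_elim
    case (elim k)
    define G where "G = partial_steps \<gamma> (Suc k)"
    have G: "0 \<le> G" using \<Gamma> by (simp add: G_def del: partial_steps_Suc)
    have "p / 2 * G \<le> exp (p / 2 * G)"
      using exp_ge_add_one_self[of "p / 2 * G"] by linarith
    then have "G \<le> 2 / p * exp (p / 2 * G)" using p by (simp add: field_simps)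
    then have "G * exp (- p * G) \<le> 2 / p * exp (p / 2 * G) * exp (- p * G)"
      by (intro mult_right_mono) auto
    also have "\<dots> = 2 / p * exp (- (p / 2) * G)"
      by (simp add: mult.assoc exp_add[symmetric])
    finally have "c * (G * exp (- p * G)) \<le> c * (2 / p * exp (- (p / 2) * G))"
      using c by (intro mult_left_mono) auto
    moreover have "\<gamma> (Suc k) \<le> c * (G * exp (- p * G))"
      using elim \<gamma>[of k] G by (simp add: G_def[symmetric] del: partial_steps_Suc)
    ultimately have "\<gamma> (Suc k) * \<gamma> (Suc k) \<le> \<gamma> (Suc k) * (c * (2 / p * exp (- (p / 2) * G)))"
      using \<gamma>[of k] by (intro mult_left_mono) auto
    then show ?case by (simp add: G_def[symmetric] power2_eq_square algebra_simps del: partial_steps_Suc)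
  qed
  then show ?thesis
    by (rule summable_comparison_test_ev) (intro summable_mult summable_step_exp \<gamma>, use p in simp)
qed

text \<open>Since ln (1 + t) \<le> t, the terms dominate the increments of ln \<Gamma>, which tends
  to infinity.\<close>

lemma not_summable_step_ratio:
  assumes \<gamma>: "\<And>k. 0 < \<gamma> (Suc k)" and div: "filterlim (partial_steps \<gamma>) at_top sequentially"
  shows "\<not> summable (\<lambda>k. \<gamma> (Suc k) / partial_steps \<gamma> k)"
proof
  assume "summable (\<lambda>k. \<gamma> (Suc k) / partial_steps \<gamma> k)"
  \<comment> \<open>Index 0 is dropped because \<Gamma>_0 = 0 would appear as a denominator and
    under the logarithm.\<close>
  then have s: "summable (\<lambda>k. \<gamma> (Suc (Suc k)) / partial_steps \<gamma> (Suc k))"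
    by (subst (asm) summable_Suc_iff[symmetric])
  have pos: "0 < partial_steps \<gamma> (Suc k)" for k
    using partial_steps_mono[of \<gamma> 0 k] \<gamma> less_imp_le[OF \<gamma>] by (simp add: add_nonneg_pos)
  let ?l = "\<lambda>k. ln (partial_steps \<gamma> (Suc k))"
  have step: "?l (Suc k) - ?l k \<le> \<gamma> (Suc (Suc k)) / partial_steps \<gamma> (Suc k)" for k
  proof -
    have "?l (Suc k) - ?l k = ln (partial_steps \<gamma> (Suc (Suc k)) / partial_steps \<gamma> (Suc k))"
      using pos[of k] pos[of "Suc k"] by (subst ln_div) (auto simp del: partial_steps_Suc)
    also have "partial_steps \<gamma> (Suc (Suc k)) / partial_steps \<gamma> (Suc k)
        = 1 + \<gamma> (Suc (Suc k)) / partial_steps \<gamma> (Suc k)"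
      using pos[of k] by (subst partial_steps_Suc) (simp add: add_divide_distrib del: partial_steps_Suc)
    also have "ln \<dots> \<le> \<gamma> (Suc (Suc k)) / partial_steps \<gamma> (Suc k)"
      using pos[of k] \<gamma>[of "Suc k"] by (intro ln_add_one_self_le_self divide_nonneg_pos) auto
    finally show ?thesis .
  qed
  let ?S = "\<Sum>k. \<gamma> (Suc (Suc k)) / partial_steps \<gamma> (Suc k)"
  have "?l n \<le> ?l 0 + ?S" for n
  proof -
    have "?l n - ?l 0 = (\<Sum>k<n. ?l (Suc k) - ?l k)" by (rule sum_lessThan_telescope[symmetric])
    also have "\<dots> \<le> (\<Sum>k<n. \<gamma> (Suc (Suc k)) / partial_steps \<gamma> (Suc k))" by (intro sum_mono step)
    also have "\<dots> \<le> ?S"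
      by (intro sum_le_suminf s) (use pos \<gamma> less_imp_le in \<open>auto intro!: divide_nonneg_nonneg simp del: partial_steps_Suc\<close>)
    finally show ?thesis by simp
  qed
  moreover have "filterlim ?l at_top sequentially"
    by (rule filterlim_compose[OF ln_at_top])
       (use div in \<open>simp add: filterlim_sequentially_Suc del: partial_steps_Suc\<close>)
  then obtain n where "?l 0 + ?S + 1 \<le> ?l n"
    unfolding filterlim_at_top eventually_sequentially by blast
  ultimately show False by (meson add_le_same_cancel1 not_one_le_zero order_trans)
qed

text \<open>With p s \<ge> 1 one has exp (p (t - s)) \<ge> 1 + p (t - s) \<ge> t / s. This is why
  the multipliers \<open>l n\<close> in the infallibility proof eventually increase.\<close>

lemma exp_over_id_mono:
  assumes "0 < p" "1 / p \<le> s" "s \<le> (t :: real)"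
  shows "exp (p * s) / s \<le> exp (p * t) / t"
proof -
  have s: "0 < s" using assms by (meson divide_pos_pos less_le_trans zero_less_one)
  then have t: "0 < t" using assms by linarith
  have "1 * (t - s) \<le> p * s * (t - s)" using assms s by (intro mult_right_mono) (auto simp: field_simps)
  then have "t \<le> s * (1 + p * (t - s))" by (simp add: algebra_simps)
  also have "\<dots> \<le> s * exp (p * (t - s))" using s by (intro mult_left_mono exp_ge_add_one_self) auto
  finally have "exp (p * s) * t \<le> exp (p * s) * (s * exp (p * (t - s)))" by simp
  also have "\<dots> = s * exp (p * t)" by (simp add: exp_add[symmetric] algebra_simps)
  finally show ?thesis using s t by (simp add: field_simps)
qed

text \<open>In ln (1 - g b) = - g b + O(g^2) the linear part differs from - p g by the convergent
  noise series, and the remainder \<open>?r\<close> is summable. The limit is an exponential, hence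
  positive.\<close>

lemma exp_times_prod_convergent:
  fixes g b :: "nat \<Rightarrow> real"
  assumes g: "\<And>k. 0 \<le> g k" "\<And>k. g k < 1" and b: "\<And>k. b k \<in> {0, 1}"
    and sq: "summable (\<lambda>k. (g k)\<^sup>2)" and noise: "summable (\<lambda>k. g k * (b k - p))"
  shows "\<exists>L>0. (\<lambda>n. exp (p * (\<Sum>k<n. g k)) * (\<Prod>k<n. 1 - g k * b k)) \<longlonglongrightarrow> L"
proof -
  let ?r = "\<lambda>k. g k * b k + ln (1 - g k * b k)"
  have pos: "0 < 1 - g k * b k" for k using g[of k] b[of k] by auto
  have "g \<longlonglongrightarrow> 0"
    using tendsto_real_sqrt[OF summable_LIMSEQ_zero[OF sq]] g by simp
  then have "eventually (\<lambda>k. g k < 1/2) sequentially"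
    by (rule order_tendstoD) simp
  then have "eventually (\<lambda>k. norm (?r k) \<le> 2 * (g k)\<^sup>2) sequentially"
  proof eventually_elim
    case (elim k)
    have "\<bar>ln (1 + (- (g k * b k))) - (- (g k * b k))\<bar> \<le> 2 * (- (g k * b k))\<^sup>2"
      by (rule abs_ln_one_plus_x_minus_x_bound) (use elim g[of k] b[of k] in auto)
    then show ?case using b[of k] by (auto simp: add.commute)
  qed
  then have "summable ?r"
    by (rule summable_comparison_test_ev) (intro summable_mult sq)
  then have "summable (\<lambda>k. ?r k - g k * (b k - p))" using noise by (rule summable_diff)
  then have "(\<lambda>n. \<Sum>k<n. ?r k - g k * (b k - p)) \<longlonglongrightarrow> (\<Sum>k. ?r k - g k * (b k - p))"
    by (rule summable_LIMSEQ)
  then have "(\<lambda>n. exp (\<Sum>k<n. ?r k - g k * (b k - p))) \<longlonglongrightarrow> exp (\<Sum>k. ?r k - g k * (b k - p))"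
    by (rule tendsto_exp)
  moreover have "exp (\<Sum>k<n. ?r k - g k * (b k - p))
      = exp (p * (\<Sum>k<n. g k)) * (\<Prod>k<n. 1 - g k * b k)" for n
  proof (induction n)
    case (Suc n)
    have "exp (?r n - g n * (b n - p)) = exp (p * g n) * (1 - g n * b n)"
      using pos[of n] by (simp add: algebra_simps exp_add)
    then show ?case using Suc by (simp add: exp_add distrib_left)
  qed simp
  ultimately show ?thesis by (intro exI[of _ "exp (\<Sum>k. ?r k - g k * (b k - p))"]) auto
qed

text \<open>\<Gamma>_n lies between two logarithms. The upper one and p_B C \<le> 1 give exp (- p_B
  \<Gamma>_n) \<ge> \<gamma>_n; the lower one bounds the products by a constant times n^(- p_A C),
  where p_A C > 1.\<close>

lemma step_condition_harmonic:
  assumes p: "0 < p\<^sub>B" "p\<^sub>B < p\<^sub>A" "p\<^sub>A \<le> 1" and C: "1 / p\<^sub>A < C" "C \<le> 1 / p\<^sub>B"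
  shows "step_condition p\<^sub>A p\<^sub>B (\<lambda>n. C / (C + real n))"
proof -
  let ?\<gamma> = "\<lambda>n. C / (C + real n)"
  have C0: "0 < C" using C(1) p by (meson divide_pos_pos less_trans zero_less_one)
  have pAC: "1 < p\<^sub>A * C" using C(1) p by (simp add: field_simps)
  have pBC: "p\<^sub>B * C \<le> 1" using C(2) p by (simp add: field_simps)
  have \<gamma>0: "0 \<le> ?\<gamma> k" for k using C0 by simp
  have upper: "partial_steps ?\<gamma> n \<le> C * ln ((C + real n) / C)" for n
  proof (induction n)
    case (Suc n)
    let ?x = "C + real (Suc n)"
    have x: "0 < ?x" "0 < C + real n" using C0 by auto
    have "ln ((C + real n) / ?x) \<le> (C + real n) / ?x - 1"
      using x by (intro ln_le_minus_one) simp
    also have "\<dots> = - (1 / ?x)" using x by (simp add: field_simps)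
    finally have "1 / ?x \<le> ln ?x - ln (C + real n)" using x by (simp add: ln_div)
    then have "C * (1 / ?x) \<le> C * (ln ?x - ln (C + real n))" using C0 by (intro mult_left_mono) auto
    then have "C * (1 / ?x) \<le> C * ln (?x / C) - C * ln ((C + real n) / C)"
      using x C0 by (simp add: ln_div right_diff_distrib del: of_nat_Suc)
    then show ?case using Suc.IH by simp
  qed (use C0 in simp)
  have lower: "C * ln ((C + 1 + real n) / (C + 1)) \<le> partial_steps ?\<gamma> n" for n
  proof (induction n)
    case (Suc n)
    let ?x = "C + 1 + real n"
    have x: "0 < ?x" "0 < C + 1" "0 < ?x + 1" using C0 by auto
    have "ln ((?x + 1) / ?x) \<le> (?x + 1) / ?x - 1"
      using x by (intro ln_le_minus_one) simp
    also have "\<dots> = 1 / ?x" using x by (simp add: field_simps)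
    finally have "ln (?x + 1) - ln ?x \<le> 1 / ?x" using x by (simp add: ln_div)
    then have "C * (ln (?x + 1) - ln ?x) \<le> C * (1 / ?x)" using C0 by (intro mult_left_mono) auto
    then have "C * ln ((?x + 1) / (C + 1)) - C * ln (?x / (C + 1)) \<le> C * (1 / ?x)"
      using x by (simp add: ln_div right_diff_distrib)
    moreover have eqs: "C + 1 + real (Suc n) = ?x + 1" "C + real (Suc n) = ?x" by auto
    ultimately show ?case using Suc.IH unfolding partial_steps_Suc eqs by simp
  qed (use C0 in simp)
  have "?\<gamma> \<in> O(\<lambda>n. partial_steps ?\<gamma> n * exp (- p\<^sub>B * partial_steps ?\<gamma> n))"
  \<comment> \<open>The constant 1 / \<gamma>_1 brings in the factor \<Gamma>_n, because \<Gamma>_n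
    \<ge> \<gamma>_1.\<close>
  proof (rule bigoI[where c="1 / ?\<gamma> 1"], rule eventually_sequentiallyI[of 1])
    fix n :: nat assume "1 \<le> n"
    then have G: "?\<gamma> 1 \<le> partial_steps ?\<gamma> n"
      using partial_steps_mono[of ?\<gamma> 1 n, OF \<gamma>0] by simp
    let ?y = "(C + real n) / C"
    have y: "1 \<le> ?y" using C0 by simp
    have "p\<^sub>B * partial_steps ?\<gamma> n \<le> p\<^sub>B * (C * ln ?y)" using upper p by (intro mult_left_mono) auto
    also have "\<dots> \<le> 1 * ln ?y" using pBC y by (simp only: mult.assoc[symmetric]) (intro mult_right_mono, auto)
    finally have "exp (- ln ?y) \<le> exp (- p\<^sub>B * partial_steps ?\<gamma> n)" by simp
    then have "?\<gamma> n \<le> exp (- p\<^sub>B * partial_steps ?\<gamma> n)"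
      using y C0 by (simp add: exp_minus)
    also have "\<dots> \<le> partial_steps ?\<gamma> n / ?\<gamma> 1 * exp (- p\<^sub>B * partial_steps ?\<gamma> n)"
    proof -
      have "0 < ?\<gamma> 1" using C0 by simp
      then have "1 \<le> partial_steps ?\<gamma> n / ?\<gamma> 1" using G by (subst le_divide_eq_1_pos) auto
      then have "1 * exp (- p\<^sub>B * partial_steps ?\<gamma> n) \<le> partial_steps ?\<gamma> n / ?\<gamma> 1 * exp (- p\<^sub>B * partial_steps ?\<gamma> n)"
        by (intro mult_right_mono) auto
      then show ?thesis by simp
    qed
    finally have "?\<gamma> n \<le> partial_steps ?\<gamma> n / ?\<gamma> 1 * exp (- p\<^sub>B * partial_steps ?\<gamma> n)" .
    moreover have "0 \<le> partial_steps ?\<gamma> n" using G \<gamma>0[of 1] by linarith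
    moreover have "norm x \<le> 1 / d * norm (G * exp y)" if "x \<le> G / d * exp y" "0 \<le> x" "0 \<le> G"
      for x d G y :: real
      using that by (simp add: abs_mult)
    ultimately show "norm (?\<gamma> n) \<le> 1 / ?\<gamma> 1 * norm (partial_steps ?\<gamma> n * exp (- p\<^sub>B * partial_steps ?\<gamma> n))"
      using \<gamma>0[of n] by blast
  qed
  moreover have "summable (\<lambda>n. \<Prod>k=1..Suc n. 1 - p\<^sub>A * ?\<gamma> k)"
  proof (rule summable_comparison_test)
    have f: "0 \<le> 1 - p\<^sub>A * ?\<gamma> k" for k
    proof -
      have "p\<^sub>A * ?\<gamma> k \<le> 1 * 1" using p C0 by (intro mult_mono) auto
      then show ?thesis by simp
    qed
    have "norm (\<Prod>k=1..Suc n. 1 - p\<^sub>A * ?\<gamma> k) \<le> (C + 1) powr (p\<^sub>A * C) * real n powr (- (p\<^sub>A * C))"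
      if n: "1 \<le> n" for n
    proof -
      have "norm (\<Prod>k=1..Suc n. 1 - p\<^sub>A * ?\<gamma> k) = (\<Prod>k=1..Suc n. 1 - p\<^sub>A * ?\<gamma> k)"
        using f by (simp add: prod_nonneg del: prod.cl_ivl_Suc)
      also have "\<dots> \<le> (\<Prod>k=1..Suc n. exp (- p\<^sub>A * ?\<gamma> k))"
        using f exp_ge_add_one_self[of "- p\<^sub>A * ?\<gamma> k" for k] by (intro prod_mono) (simp del: exp_ge_add_one_self)
      also have "\<dots> = exp (- (p\<^sub>A * partial_steps ?\<gamma> (Suc n)))"
        by (simp only: exp_sum[symmetric] finite_atLeastAtMost partial_steps_def sum_distrib_left sum_negf[symmetric] mult_minus_left)
      also have "\<dots> \<le> exp (- (p\<^sub>A * (C * ln ((C + 1 + real (Suc n)) / (C + 1)))))"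
        using lower[of "Suc n"] p by (simp del: partial_steps_Suc of_nat_Suc)
      also have "\<dots> = ((C + 1 + real (Suc n)) / (C + 1)) powr (- (p\<^sub>A * C))"
        using C0 by (simp add: powr_def)
      \<comment> \<open>The exponent is negative, so passing to the smaller base n / (C + 1)
        increases the value and leaves a pure power of n.\<close>
      also have "\<dots> \<le> (real n / (C + 1)) powr (- (p\<^sub>A * C))"
        using C0 n pAC by (intro powr_mono2') (auto intro!: divide_right_mono)
      also have "\<dots> = (C + 1) powr (p\<^sub>A * C) * real n powr (- (p\<^sub>A * C))"
        using C0 n by (simp add: powr_divide powr_minus field_simps)
      finally show ?thesis .
    qed
    then show "\<exists>N. \<forall>n\<ge>N. norm (\<Prod>k=1..Suc n. 1 - p\<^sub>A * ?\<gamma> k) \<le> (C + 1) powr (p\<^sub>A * C) * real n powr (- (p\<^sub>A * C))"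
      by blast
    show "summable (\<lambda>n. (C + 1) powr (p\<^sub>A * C) * real n powr (- (p\<^sub>A * C)))"
      using pAC by (intro summable_mult) (simp add: summable_real_powr_iff)
  qed
  ultimately show ?thesis unfolding step_condition_def by blast
qed

section \<open>One independent family holding both arm outcomes and uniforms\<close>

section \<open>Independence structure of the bandit\<close>

context two_armed_bandit begin

text \<open>\<open>indep_vars\<close> wants a common value type, so \<open>U n\<close> is padded with a zero component.\<close>

definition noise :: "nat + nat \<Rightarrow> 'w \<Rightarrow> real \<times> real" where
  "noise = case_sum (arm_outcome A B) (\<lambda>n \<omega>. (U n \<omega>, 0))"

lemma noise_simps [simp]:
  "noise (Inl n) = arm_outcome A B n" "noise (Inr n) = (\<lambda>\<omega>. (U n \<omega>, 0))"
  by (simp_all add: noise_def)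

definition noise_index :: "(nat + nat) set" where
  "noise_index = Inl ` {1..} \<union> Inr ` {1..}"

lemma U_measurable: "1 \<le> n \<Longrightarrow> U n \<in> borel_measurable M"
  using U_indep by (auto simp: indep_vars_def)

lemma arm_outcome_measurable: "1 \<le> n \<Longrightarrow> arm_outcome A B n \<in> borel_measurable M"
  using arms_indep by (auto simp: indep_vars_def)

lemma noise_measurable:
  assumes "i \<in> noise_index" shows "noise i \<in> borel_measurable M"
proof (cases i)
  case (Inl n)
  then show ?thesis using assms arm_outcome_measurable by (auto simp: noise_index_def)
next
  case (Inr n)
  then have [measurable]: "U n \<in> borel_measurable M"
    using assms U_measurable by (auto simp: noise_index_def)
  show ?thesis unfolding Inr noise_simps borel_prod[symmetric] by measurable
qed

text \<open>A finite subfamily splits into arm outcomes and uniforms: \<open>arms_indep_U\<close>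
  separates the two groups, and each group factorises by its own independence.\<close>

lemma noise_indep: "indep_vars (\<lambda>_. borel) noise noise_index"
  unfolding indep_vars_def2
proof (intro conjI ballI noise_measurable indep_setsI)
  let ?VA = "vimage_algebra (space M) (\<lambda>\<omega>. \<lambda>n\<in>{1..}. arm_outcome A B n \<omega>) (PiM {1..} (\<lambda>_. borel))"
  let ?VU = "vimage_algebra (space M) (\<lambda>\<omega>. \<lambda>n\<in>{1..}. U n \<omega>) (PiM {1..} (\<lambda>_. borel))"
  show "{noise i -` S \<inter> space M |S. S \<in> sets borel} \<subseteq> events" if "i \<in> noise_index" for i
    using measurable_sets[OF noise_measurable[OF that]] by auto
  fix S J assume J: "J \<noteq> {}" "J \<subseteq> noise_index" "finite J"
    and S: "\<forall>j\<in>J. S j \<in> {noise j -` T \<inter> space M |T. T \<in> sets borel}"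
  define JA JU where "JA = {n. Inl n \<in> J}" and "JU = {n. Inr n \<in> J}"
  have J_eq: "J = Inl ` JA \<union> Inr ` JU"
  proof (rule set_eqI)
    fix j show "j \<in> J \<longleftrightarrow> j \<in> Inl ` JA \<union> Inr ` JU"
      by (cases j) (auto simp: JA_def JU_def)
  qed
  have fin: "finite JA" "finite JU"
    using J(3) unfolding J_eq by (auto dest: finite_imageD[OF _ inj_on_subset[OF inj_Inl]] finite_imageD[OF _ inj_on_subset[OF inj_Inr]])
  have pos: "JA \<subseteq> {1..}" "JU \<subseteq> {1..}" using J(2) unfolding J_eq noise_index_def by auto
  have SA: "S (Inl n) \<in> {arm_outcome A B n -` T \<inter> space M |T. T \<in> sets borel}" if "n \<in> JA" for n
    using bspec[OF S, of "Inl n"] that by (simp add: JA_def)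
  \<comment> \<open>Padding adds no events: a preimage under the padded variable is already a
    preimage under \<open>U n\<close>.\<close>
  have SU: "S (Inr n) \<in> {U n -` T \<inter> space M |T. T \<in> sets borel}" if n: "n \<in> JU" for n
  proof -
    from S n obtain T where T: "S (Inr n) = (\<lambda>\<omega>. (U n \<omega>, 0 :: real)) -` T \<inter> space M" "T \<in> sets borel"
      by (auto simp: JU_def)
    have m: "(\<lambda>u :: real. (u, 0 :: real)) \<in> borel_measurable borel"
      unfolding borel_prod[symmetric] by measurable
    have "S (Inr n) = U n -` ((\<lambda>u. (u, 0)) -` T) \<inter> space M" using T(1) by auto
    moreover have "(\<lambda>u. (u, 0 :: real)) -` T \<in> sets borel"
      using measurable_sets[OF m T(2)] by simp
    ultimately show ?thesis by blast
  qed
  \<comment> \<open>As comprehensions these sets are \<open>space M\<close> for an empty index set,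
    where an intersection would be \<open>UNIV\<close>.\<close>
  let ?a = "{\<omega>\<in>space M. \<forall>n\<in>JA. \<omega> \<in> S (Inl n)}" and ?u = "{\<omega>\<in>space M. \<forall>n\<in>JU. \<omega> \<in> S (Inr n)}"
  have "(\<Inter>j\<in>J. S j) = ?a \<inter> ?u"
  proof -
    have "S j \<subseteq> space M" if "j \<in> J" for j using S that by auto
    moreover obtain j where "j \<in> J" using J(1) by auto
    ultimately have "(\<Inter>j\<in>J. S j) = {\<omega>\<in>space M. \<forall>j\<in>J. \<omega> \<in> S j}" by auto
    then show ?thesis unfolding J_eq by auto
  qed
  also have "prob (?a \<inter> ?u) = prob ?a * prob ?u"
  proof (rule indep_setD[OF arms_indep_U])
    have "{\<omega>\<in>space ?VA. \<forall>n\<in>JA. \<omega> \<in> S (Inl n)} \<in> sets ?VA"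
    proof (rule sets.sets_Collect_finite_All[OF _ fin(1)])
      fix n assume n: "n \<in> JA"
      have "(\<lambda>\<omega>. (\<lambda>f. f n) (\<lambda>n\<in>{1..}. arm_outcome A B n \<omega>)) \<in> borel_measurable ?VA"
        by (rule measurable_compose[OF measurable_vimage_algebra1 measurable_component_singleton])
           (use pos n in \<open>auto simp: space_PiM split: if_splits\<close>)
      then have m: "arm_outcome A B n \<in> borel_measurable ?VA" using pos n by auto
      obtain T where "S (Inl n) = arm_outcome A B n -` T \<inter> space M" "T \<in> sets borel" using SA[OF n] by auto
      then have "S (Inl n) \<in> sets ?VA" using measurable_sets[OF m, of T] by simp
      then have "space ?VA \<inter> S (Inl n) \<in> sets ?VA" by (rule sets.Int[OF sets.top])
      then show "{\<omega>\<in>space ?VA. \<omega> \<in> S (Inl n)} \<in> sets ?VA" by (simp only: Collect_conj_eq Collect_mem_eq)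
    qed
    then show "?a \<in> sets ?VA" by simp
    have "{\<omega>\<in>space ?VU. \<forall>n\<in>JU. \<omega> \<in> S (Inr n)} \<in> sets ?VU"
    proof (rule sets.sets_Collect_finite_All[OF _ fin(2)])
      fix n assume n: "n \<in> JU"
      have "(\<lambda>\<omega>. (\<lambda>f. f n) (\<lambda>n\<in>{1..}. U n \<omega>)) \<in> borel_measurable ?VU"
        by (rule measurable_compose[OF measurable_vimage_algebra1 measurable_component_singleton])
           (use pos n in \<open>auto simp: space_PiM split: if_splits\<close>)
      then have m: "U n \<in> borel_measurable ?VU" using pos n by auto
      obtain T where "S (Inr n) = U n -` T \<inter> space M" "T \<in> sets borel" using SU[OF n] by auto
      then have "S (Inr n) \<in> sets ?VU" using measurable_sets[OF m, of T] by simp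
      then have "space ?VU \<inter> S (Inr n) \<in> sets ?VU" by (rule sets.Int[OF sets.top])
      then show "{\<omega>\<in>space ?VU. \<omega> \<in> S (Inr n)} \<in> sets ?VU" by (simp only: Collect_conj_eq Collect_mem_eq)
    qed
    then show "?u \<in> sets ?VU" by simp
  qed
  also have "prob ?a = (\<Prod>n\<in>JA. prob (S (Inl n)))"
  proof (cases "JA = {}")
    case False
    have "indep_sets (\<lambda>n. {arm_outcome A B n -` T \<inter> space M |T. T \<in> sets borel}) {1..}"
      using arms_indep unfolding indep_vars_def2 by blast
    from indep_setsD[OF this pos(1) False fin(1)] SA
    have "prob (\<Inter>n\<in>JA. S (Inl n)) = (\<Prod>n\<in>JA. prob (S (Inl n)))" by auto
    moreover have "(\<Inter>n\<in>JA. S (Inl n)) = ?a" using False SA by auto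
    ultimately show ?thesis by simp
  qed (simp add: prob_space)
  also have "prob ?u = (\<Prod>n\<in>JU. prob (S (Inr n)))"
  proof (cases "JU = {}")
    case False
    have "indep_sets (\<lambda>n. {U n -` T \<inter> space M |T. T \<in> sets borel}) {1..}"
      using U_indep unfolding indep_vars_def2 by blast
    from indep_setsD[OF this pos(2) False fin(2)] SU
    have "prob (\<Inter>n\<in>JU. S (Inr n)) = (\<Prod>n\<in>JU. prob (S (Inr n)))" by auto
    moreover have "(\<Inter>n\<in>JU. S (Inr n)) = ?u" using False SU by auto
    ultimately show ?thesis by simp
  qed (simp add: prob_space)
  also have "(\<Prod>n\<in>JA. prob (S (Inl n))) * (\<Prod>n\<in>JU. prob (S (Inr n))) = (\<Prod>j\<in>J. prob (S j))"
    unfolding J_eq using fin by (subst prod.union_disjoint) (auto simp: prod.reindex)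
  finally show "prob (\<Inter>j\<in>J. S j) = (\<Prod>j\<in>J. prob (S j))" .
qed

abbreviation info :: "(nat + nat) set \<Rightarrow> 'w measure" where
  "info \<equiv> family_algebra M noise"

lemma info_subalgebra:
  assumes "f \<in> measurable (info K) N" "K \<subseteq> noise_index" shows "f \<in> measurable M N"
  using measurable_family_algebra_subalgebra[OF assms(1)] noise_measurable assms(2) by blast

lemma integrable_info:
  fixes f :: "'w \<Rightarrow> real"
  assumes "f \<in> borel_measurable (info K)" "K \<subseteq> noise_index" "\<And>\<omega>. \<bar>f \<omega>\<bar> \<le> c"
  shows "integrable M f"
  by (rule integrable_const_bound[where B=c]) (use assms info_subalgebra in auto)

lemma U_info: "Inr n \<in> K \<Longrightarrow> U n \<in> borel_measurable (info K)"
  using measurable_compose[OF measurable_family_algebra[of "Inr n" K noise M, folded borel_prod] measurable_fst]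
  by simp

lemma A_info: "Inl n \<in> K \<Longrightarrow> (indicator (A n) :: 'w \<Rightarrow> real) \<in> borel_measurable (info K)"
  using measurable_compose[OF measurable_family_algebra[of "Inl n" K noise M, folded borel_prod] measurable_fst]
  by (simp add: arm_outcome_def)

lemma B_info: "Inl n \<in> K \<Longrightarrow> (indicator (B n) :: 'w \<Rightarrow> real) \<in> borel_measurable (info K)"
  using measurable_compose[OF measurable_family_algebra[of "Inl n" K noise M, folded borel_prod] measurable_snd]
  by (simp add: arm_outcome_def)

text \<open>\<open>arms_ident\<close> compares laws of pairs; each arm event is the preimage of a
  closed set on which one coordinate equals 1.\<close>

lemma prob_arm:
  assumes "1 \<le> n" shows "prob (A n) = p\<^sub>A" "prob (B n) = p\<^sub>B"
proof -
  have eq: "prob (arm_outcome A B n -` S \<inter> space M) = prob (arm_outcome A B 1 -` S \<inter> space M)"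
    if "S \<in> sets borel" for S
    using arms_ident[OF assms] that arm_outcome_measurable assms
    by (metis measure_distr order_refl)
  have vimage: "arm_outcome A B k -` {z. fst z = 1} \<inter> space M = A k"
    "arm_outcome A B k -` {z. snd z = 1} \<inter> space M = B k" if "1 \<le> k" for k
    using sets.sets_into_space[OF A_events[OF that]] sets.sets_into_space[OF B_events[OF that]]
    by (auto simp: arm_outcome_def indicator_eq_1_iff)
  have S: "{z :: real \<times> real. fst z = 1} \<in> sets borel" "{z :: real \<times> real. snd z = 1} \<in> sets borel"
    by (auto intro!: borel_closed closed_Collect_eq continuous_intros)
  show "prob (A n) = p\<^sub>A" using eq[OF S(1)] unfolding vimage(1)[OF assms] vimage(1)[OF order_refl] prob_A .
  show "prob (B n) = p\<^sub>B" using eq[OF S(2)] unfolding vimage(2)[OF assms] vimage(2)[OF order_refl] prob_B .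
qed

text \<open>The distribution function of a uniform variable is the identity on [0, 1], so averaging
  out \<open>U n\<close> turns the selection of arm A into its conditional probability g.\<close>

lemma expectation_U_threshold:
  fixes f g :: "'w \<Rightarrow> real"
  assumes K: "K \<subseteq> noise_index" "1 \<le> n" "Inr n \<notin> K"
    and f: "f \<in> borel_measurable (info K)" "\<And>\<omega>. \<bar>f \<omega>\<bar> \<le> c"
    and g: "g \<in> borel_measurable (info K)" "\<And>\<omega>. 0 \<le> g \<omega> \<and> g \<omega> \<le> 1"
  shows "expectation (\<lambda>\<omega>. f \<omega> * indicator {\<omega>. U n \<omega> \<le> g \<omega>} \<omega>) = expectation (\<lambda>\<omega>. f \<omega> * g \<omega>)"
proof -
  have fst: "(fst :: real \<times> real \<Rightarrow> real) \<in> borel_measurable borel"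
    unfolding borel_prod[symmetric] by measurable
  have "expectation (\<lambda>\<omega>. f \<omega> * indicator {\<omega>. U n \<omega> \<le> g \<omega>} \<omega>)
      = expectation (\<lambda>\<omega>. f \<omega> * measure (distr M borel (U n)) {..g \<omega>})"
    by (rule expectation_threshold[OF noise_indep K(1) _ K(3) f g(1) _ fst])
       (use K in \<open>auto simp: noise_index_def\<close>)
  also have "measure (distr M borel (U n)) {..t} = t" if "0 \<le> t" "t \<le> 1" for t
  proof -
    have "{0..1} \<inter> {..t} = {0..t}" using that by auto
    then show ?thesis
      unfolding U_uniform[OF K(2)] using that by (subst measure_uniform_measure) auto
  qed
  then have "expectation (\<lambda>\<omega>. f \<omega> * measure (distr M borel (U n)) {..g \<omega>}) = expectation (\<lambda>\<omega>. f \<omega> * g \<omega>)"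
    using g(2) by (intro Bochner_Integration.integral_cong) auto
  finally show ?thesis .
qed

text \<open>\<open>K\<close> may contain \<open>Inr n\<close>, so the outcome can be averaged out
  while the selection made by \<open>U n\<close> at the same step is still present.\<close>

lemma expectation_arm:
  fixes f :: "'w \<Rightarrow> real"
  assumes K: "K \<subseteq> noise_index" "1 \<le> n" "Inl n \<notin> K"
    and f: "f \<in> borel_measurable (info K)" "\<And>\<omega>. \<bar>f \<omega>\<bar> \<le> c"
  shows "expectation (\<lambda>\<omega>. f \<omega> * indicator (A n) \<omega>) = expectation f * p\<^sub>A"
    and "expectation (\<lambda>\<omega>. f \<omega> * indicator (B n) \<omega>) = expectation f * p\<^sub>B"
proof -
  have n: "{Inl n} \<subseteq> noise_index" "K \<inter> {Inl n} = {}" using K by (auto simp: noise_index_def)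
  have fi: "integrable M f" by (rule integrable_info[OF f(1) K(1) f(2)])
  note ind = indep_var_family_algebra[OF noise_indep K(1) n f(1)]
  have "indep_var borel f borel (indicator (A n))" by (rule ind) (rule A_info, simp)
  moreover have "integrable M (indicator (A n) :: 'w \<Rightarrow> real)"
    using A_events[OF K(2)] by (auto simp: emeasure_eq_measure)
  ultimately have "expectation (\<lambda>\<omega>. f \<omega> * indicator (A n) \<omega>) = expectation f * expectation (indicator (A n))"
    by (rule indep_var_lebesgue_integral[OF _ fi])
  with prob_arm[OF K(2)] A_events[OF K(2)]
  show "expectation (\<lambda>\<omega>. f \<omega> * indicator (A n) \<omega>) = expectation f * p\<^sub>A" by simp
  have "indep_var borel f borel (indicator (B n))" by (rule ind) (rule B_info, simp)
  moreover have "integrable M (indicator (B n) :: 'w \<Rightarrow> real)"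
    using B_events[OF K(2)] by (auto simp: emeasure_eq_measure)
  ultimately have "expectation (\<lambda>\<omega>. f \<omega> * indicator (B n) \<omega>) = expectation f * expectation (indicator (B n))"
    by (rule indep_var_lebesgue_integral[OF _ fi])
  with prob_arm[OF K(2)] B_events[OF K(2)]
  show "expectation (\<lambda>\<omega>. f \<omega> * indicator (B n) \<omega>) = expectation f * p\<^sub>B" by simp
qed

end

section \<open>One-step drift of exp (- l X) given the past\<close>

section \<open>The exponential supermartingale\<close>

text \<open>Via exp (- v) \<le> 1 / (1 + v) and (1 - v + v^2) (1 + v) = 1 + v^3 \<ge> 1.\<close>

lemma exp_minus_le_quadratic:
  fixes v :: real assumes "0 \<le> v" shows "exp (- v) - 1 \<le> - v + v\<^sup>2"
proof -
  have "exp (- v) \<le> 1 / (1 + v)"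
    using exp_ge_add_one_self[of v] assms by (simp add: exp_minus field_simps)
  also have "1 / (1 + v) \<le> 1 - v + v\<^sup>2"
  proof -
    have "(1 - v + v\<^sup>2) * (1 + v) = 1 + v ^ 3" by (simp add: algebra_simps power2_eq_square power3_eq_cube)
    then have "1 \<le> (1 - v + v\<^sup>2) * (1 + v)" using assms by simp
    then show ?thesis using assms by (simp add: divide_le_eq)
  qed
  finally show ?thesis by simp
qed

text \<open>With u = l \<gamma> the left side is the conditional mean of the relative change of exp
  (- l X): X moves up by \<gamma> (1 - X) with probability a X and down by \<gamma> X with
  probability b (1 - X). The first order terms leave - (a - b) u X (1 - X), and u \<le> (a - b) / 3
  keeps the second order ones within a third of its modulus.\<close>

lemma exp_drift_bound:
  fixes u X a b :: real
  assumes X: "0 \<le> X" "X \<le> 1" and u: "0 \<le> u" "u \<le> (a - b) / 3" and ab: "0 \<le> b" "b < a" "a \<le> 1"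
  shows "a * X * (exp (- (u * (1 - X))) - 1) + b * (1 - X) * (exp (u * X) - 1)
    \<le> - ((a - b) / 2 * u * X * (1 - X))"
proof -
  let ?Z = "u * X * (1 - X)"
  have Z: "0 \<le> ?Z" using X u by simp
  have "u \<le> 1" using u ab by simp
  then have uX: "u * X \<le> 1" using X u by (simp add: mult_le_one)
  have "exp (- (u * (1 - X))) - 1 \<le> - (u * (1 - X)) + (u * (1 - X))\<^sup>2"
    using X u by (intro exp_minus_le_quadratic) simp
  then have 1: "a * X * (exp (- (u * (1 - X))) - 1) \<le> a * X * (- (u * (1 - X)) + (u * (1 - X))\<^sup>2)"
    using X ab by (intro mult_left_mono) auto
  have "exp (u * X) - 1 \<le> u * X + (u * X)\<^sup>2"
    using exp_bound[of "u * X"] X u uX by simp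
  then have 2: "b * (1 - X) * (exp (u * X) - 1) \<le> b * (1 - X) * (u * X + (u * X)\<^sup>2)"
    using X ab by (intro mult_left_mono) auto
  have eq: "a * X * (- (u * (1 - X)) + (u * (1 - X))\<^sup>2) + b * (1 - X) * (u * X + (u * X)\<^sup>2)
      = ?Z * (- (a - b) + u * (a * (1 - X) + b * X))"
    by (simp add: algebra_simps power2_eq_square)
  have "a * (1 - X) + b * X \<le> 1 * (1 - X) + 1 * X"
    using X ab by (intro add_mono mult_right_mono) auto
  then have "u * (a * (1 - X) + b * X) \<le> u * 1" using u by (intro mult_left_mono) auto
  then have "- (a - b) + u * (a * (1 - X) + b * X) \<le> - ((a - b) / 2)"
    using u(2) ab(2) unfolding mult_1_right by argo
  then have "?Z * (- (a - b) + u * (a * (1 - X) + b * X)) \<le> ?Z * - ((a - b) / 2)"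
    using Z by (intro mult_left_mono) auto
  also have "?Z * - ((a - b) / 2) = - ((a - b) / 2 * u * X * (1 - X))" by (simp add: mult_ac)
  finally show ?thesis using add_mono[OF 1 2] unfolding eq by (rule order_trans[rotated])
qed

text \<open>By monotone convergence the full sum has finite expectation, so it is almost surely
  finite.\<close>

lemma (in prob_space) AE_summable_of_bounded_expectation:
  fixes g :: "nat \<Rightarrow> 'a \<Rightarrow> real"
  assumes g: "\<And>k. integrable M (g k)" "\<And>k \<omega>. 0 \<le> g k \<omega>"
    and bound: "\<And>n. expectation (\<lambda>\<omega>. \<Sum>k<n. g k \<omega>) \<le> c"
  shows "AE \<omega> in M. summable (\<lambda>k. g k \<omega>)"
proof -
  have [measurable]: "g k \<in> borel_measurable M" for k using g(1) by auto
  have "(\<integral>\<^sup>+\<omega>. (\<Sum>k. ennreal (g k \<omega>)) \<partial>M) = (\<Sum>k. \<integral>\<^sup>+\<omega>. ennreal (g k \<omega>) \<partial>M)"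
    by (rule nn_integral_suminf) measurable
  also have "\<dots> = (\<Sum>k. ennreal (expectation (g k)))"
    using nn_integral_eq_integral[OF g(1)] g(2) by (intro suminf_cong) auto
  also have "\<dots> \<le> ennreal c"
    unfolding suminf_eq_SUP
  proof (rule SUP_least)
    fix n
    have "(\<Sum>k<n. ennreal (expectation (g k))) = ennreal (expectation (\<lambda>\<omega>. \<Sum>k<n. g k \<omega>))"
      using g by (subst sum_ennreal) (auto simp: integral_nonneg_AE)
    also have "\<dots> \<le> ennreal c" by (intro ennreal_leI bound)
    finally show "(\<Sum>k<n. ennreal (expectation (g k))) \<le> ennreal c" .
  qed
  finally have "(\<integral>\<^sup>+\<omega>. (\<Sum>k. ennreal (g k \<omega>)) \<partial>M) \<noteq> \<infinity>"
    using ennreal_less_top[of c] by (auto simp: top_unique)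
  then have "AE \<omega> in M. (\<Sum>k. ennreal (g k \<omega>)) \<noteq> \<infinity>"
    by (intro nn_integral_PInf_AE) measurable
  then show ?thesis
    by eventually_elim (rule summable_suminf_not_top, use g in auto)
qed

context two_armed_bandit begin

lemma step_bounds: "0 \<le> \<gamma> (Suc k)" "0 < \<gamma> (Suc k)" "\<gamma> (Suc k) < 1"
  using steps[of "Suc k"] by auto

definition hist :: "nat \<Rightarrow> (nat + nat) set" where
  "hist n = Inl ` {1..n} \<union> Inr ` {1..n}"

lemma hist_subset: "hist n \<subseteq> noise_index" and hist_mono: "m \<le> n \<Longrightarrow> hist m \<subseteq> hist n"
  and Inl_hist: "Inl k \<in> hist n \<longleftrightarrow> 1 \<le> k \<and> k \<le> n" and Inr_hist: "Inr k \<in> hist n \<longleftrightarrow> 1 \<le> k \<and> k \<le> n"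
  by (auto simp: hist_def noise_index_def)

text \<open>Selection of B is written as the complement of {U \<le> X}, so that one threshold
  indicator carries all dependence on \<open>U (Suc n)\<close> and can be averaged out.\<close>

lemma bandit_Suc_eq:
  "bandit \<gamma> U A B x (Suc n) \<omega> = bandit \<gamma> U A B x n \<omega> + \<gamma> (Suc n) *
     ((1 - bandit \<gamma> U A B x n \<omega>) * (indicator {\<omega>. U (Suc n) \<omega> \<le> bandit \<gamma> U A B x n \<omega>} \<omega> * indicator (A (Suc n)) \<omega>)
      - bandit \<gamma> U A B x n \<omega> * ((1 - indicator {\<omega>. U (Suc n) \<omega> \<le> bandit \<gamma> U A B x n \<omega>} \<omega>) * indicator (B (Suc n)) \<omega>))"
  by (auto simp: indicator_def)

lemma bandit_bounds:
  assumes "x \<in> {0<..<1}"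
  shows "0 \<le> bandit \<gamma> U A B x n \<omega> \<and> bandit \<gamma> U A B x n \<omega> \<le> 1"
proof (induction n)
  case (Suc n)
  define X g where "X = bandit \<gamma> U A B x n \<omega>" and "g = \<gamma> (Suc n)"
  have X: "0 \<le> X" "X \<le> 1" and g: "0 \<le> g" "g \<le> 1"
    using Suc step_bounds[of n] by (auto simp: X_def g_def)
  have "bandit \<gamma> U A B x (Suc n) \<omega> \<in> {X, X + g * (1 - X), X - g * X}"
    unfolding bandit_Suc_eq X_def[symmetric] g_def[symmetric] by (auto simp: indicator_def)
  moreover have "0 \<le> g * (1 - X)" "g * (1 - X) \<le> 1 - X" "0 \<le> g * X" "g * X \<le> X"
    using X g by (auto intro!: mult_left_le_one_le)
  ultimately show ?case using X by auto
qed (use assms in auto)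

text \<open>A downward move multiplies X by 1 - \<gamma> and needs the event B; all other moves do
  not lower X. This caps the speed of a fall at the order exp (- p_B \<Gamma>_n).\<close>

lemma bandit_ge_prod:
  assumes "x \<in> {0<..<1}"
  shows "x * (\<Prod>k<n. 1 - \<gamma> (Suc k) * indicator (B (Suc k)) \<omega>) \<le> bandit \<gamma> U A B x n \<omega>"
proof (induction n)
  case (Suc n)
  define X g I :: real where "X = bandit \<gamma> U A B x n \<omega>" and "g = \<gamma> (Suc n)" and "I = indicator (B (Suc n)) \<omega>"
  have X: "0 \<le> X" "X \<le> 1" and g: "0 \<le> g" "g \<le> 1"
    using bandit_bounds[OF assms, of n \<omega>] step_bounds[of n] by (auto simp: X_def g_def)
  have "0 \<le> 1 - g * I" using g by (auto simp: I_def indicator_def)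
  then have "x * (\<Prod>k<n. 1 - \<gamma> (Suc k) * indicator (B (Suc k)) \<omega>) * (1 - g * I) \<le> X * (1 - g * I)"
    using Suc unfolding X_def by (intro mult_right_mono) auto
  also have "\<dots> \<le> bandit \<gamma> U A B x (Suc n) \<omega>"
    unfolding bandit_Suc_eq X_def[symmetric] g_def[symmetric] I_def[symmetric]
    using X g mult_left_le_one_le[of g X] by (auto simp: indicator_def I_def algebra_simps)
  finally show ?case by (simp add: g_def I_def mult.assoc)
qed simp

lemma measurable_bandit_step:
  fixes X u a b :: "'c \<Rightarrow> real"
  assumes [measurable]: "X \<in> borel_measurable N" "u \<in> borel_measurable N"
    "a \<in> borel_measurable N" "b \<in> borel_measurable N"
  shows "(\<lambda>\<omega>. X \<omega> + c * ((1 - X \<omega>) * (indicator {\<omega>. u \<omega> \<le> X \<omega>} \<omega> * a \<omega>)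
      - X \<omega> * ((1 - indicator {\<omega>. u \<omega> \<le> X \<omega>} \<omega>) * b \<omega>))) \<in> borel_measurable N"
proof -
  have eq: "indicator {\<omega>. u \<omega> \<le> X \<omega>} = (\<lambda>\<omega>. if u \<omega> \<le> X \<omega> then 1 else 0 :: real)"
    by (auto simp: fun_eq_iff)
  show ?thesis unfolding eq by measurable
qed

lemma bandit_hist: "bandit \<gamma> U A B x n \<in> borel_measurable (info (hist n))"
proof (induction n)
  case 0
  show ?case by (simp only: bandit.simps) (rule borel_measurable_const)
next
  case (Suc n)
  have eq: "bandit \<gamma> U A B x (Suc n) = (\<lambda>\<omega>. bandit \<gamma> U A B x n \<omega> + \<gamma> (Suc n) *
     ((1 - bandit \<gamma> U A B x n \<omega>) * (indicator {\<omega>. U (Suc n) \<omega> \<le> bandit \<gamma> U A B x n \<omega>} \<omega> * indicator (A (Suc n)) \<omega>)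
      - bandit \<gamma> U A B x n \<omega> * ((1 - indicator {\<omega>. U (Suc n) \<omega> \<le> bandit \<gamma> U A B x n \<omega>} \<omega>) * indicator (B (Suc n)) \<omega>)))"
    by (rule ext) (rule bandit_Suc_eq)
  show ?case unfolding eq
    by (rule measurable_bandit_step[OF measurable_family_algebra_mono[OF Suc] U_info A_info B_info])
       (auto simp: Inl_hist Inr_hist hist_mono)
qed

text \<open>Averaging the arm outcome and then the uniform leaves the mean estimated in
  \<open>exp_drift_bound\<close>. The weight \<open>f\<close>, an arbitrary bounded nonnegative
  function of the past, takes the place of a conditional expectation.\<close>

lemma expectation_exp_bandit_decrease:
  fixes f :: "'w \<Rightarrow> real"
  assumes p: "0 < p\<^sub>B" "p\<^sub>B < p\<^sub>A" "p\<^sub>A \<le> 1" and x: "x \<in> {0<..<1}"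
    and l: "0 \<le> l" "l * \<gamma> (Suc m) \<le> (p\<^sub>A - p\<^sub>B) / 3"
    and f: "f \<in> borel_measurable (info (hist m))" "\<And>\<omega>. 0 \<le> f \<omega> \<and> f \<omega> \<le> K"
  shows "expectation (\<lambda>\<omega>. f \<omega> * exp (- (l * bandit \<gamma> U A B x (Suc m) \<omega>)))
    \<le> expectation (\<lambda>\<omega>. f \<omega> * exp (- (l * bandit \<gamma> U A B x m \<omega>)) *
        (1 - (p\<^sub>A - p\<^sub>B) / 2 * (l * \<gamma> (Suc m)) * bandit \<gamma> U A B x m \<omega> * (1 - bandit \<gamma> U A B x m \<omega>)))"
proof -
  let ?X = "bandit \<gamma> U A B x m"
  let ?g = "\<lambda>\<omega>. f \<omega> * exp (- (l * ?X \<omega>))"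
  define u where "u = l * \<gamma> (Suc m)"
  \<comment> \<open>Relative changes of exp (- l X) caused by an upward and by a downward
    move.\<close>
  let ?a = "\<lambda>\<omega>. exp (- (u * (1 - ?X \<omega>))) - 1" and ?b = "\<lambda>\<omega>. exp (u * ?X \<omega>) - 1"
  let ?V = "\<lambda>\<omega>. indicator {\<omega>. U (Suc m) \<omega> \<le> ?X \<omega>} \<omega> :: real"
  let ?A = "\<lambda>\<omega>. indicator (A (Suc m)) \<omega> :: real" and ?B = "\<lambda>\<omega>. indicator (B (Suc m)) \<omega> :: real"
  \<comment> \<open>The past together with the current uniform: what is known before the arm outcome
    is seen.\<close>
  let ?K = "insert (Inr (Suc m)) (hist m)"
  have u: "0 \<le> u" "u \<le> (p\<^sub>A - p\<^sub>B) / 3" using l step_bounds[of m] by (auto simp: u_def)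
  have X: "0 \<le> ?X \<omega>" "?X \<omega> \<le> 1" for \<omega> using bandit_bounds[OF x] by auto
  have K: "?K \<subseteq> noise_index" "Inl (Suc m) \<notin> ?K" "Inr (Suc m) \<notin> hist m"
    using hist_subset[of m] by (auto simp: noise_index_def Inl_hist Inr_hist)
  have meas: "f \<in> borel_measurable (info L)" "?X \<in> borel_measurable (info L)" if "hist m \<subseteq> L" for L
    using measurable_family_algebra_mono[OF f(1) that] measurable_family_algebra_mono[OF bandit_hist that] by auto
  have ga: "(\<lambda>\<omega>. ?g \<omega>) \<in> borel_measurable (info L)" "(\<lambda>\<omega>. ?g \<omega> * ?a \<omega>) \<in> borel_measurable (info L)"
    "(\<lambda>\<omega>. ?g \<omega> * ?b \<omega>) \<in> borel_measurable (info L)" if "hist m \<subseteq> L" for L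
  proof -
    note [measurable] = meas[OF that]
    show "(\<lambda>\<omega>. ?g \<omega>) \<in> borel_measurable (info L)" "(\<lambda>\<omega>. ?g \<omega> * ?a \<omega>) \<in> borel_measurable (info L)"
      "(\<lambda>\<omega>. ?g \<omega> * ?b \<omega>) \<in> borel_measurable (info L)" by measurable
  qed
  have V: "(\<lambda>\<omega>. ?V \<omega>) \<in> borel_measurable (info ?K)"
  proof -
    have [measurable]: "U (Suc m) \<in> borel_measurable (info ?K)" "?X \<in> borel_measurable (info ?K)"
      using U_info[of "Suc m" ?K] meas(2)[of ?K] by auto
    have "(\<lambda>\<omega>. ?V \<omega>) = (\<lambda>\<omega>. if U (Suc m) \<omega> \<le> ?X \<omega> then 1 else 0)" by (auto simp: fun_eq_iff)
    also have "\<dots> \<in> borel_measurable (info ?K)" by measurable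
    finally show ?thesis .
  qed
  have K0: "0 \<le> K" using f(2)[of undefined] by linarith
  have gb: "\<bar>?g \<omega>\<bar> \<le> K" for \<omega>
  proof -
    have "?g \<omega> \<le> K * 1" using f(2)[of \<omega>] X[of \<omega>] l K0 by (intro mult_mono) auto
    then show ?thesis using f(2)[of \<omega>] by simp
  qed
  have ab: "\<bar>?g \<omega> * ?a \<omega>\<bar> \<le> K * 1" for \<omega>
    unfolding abs_mult using gb[of \<omega>] K0 X[of \<omega>] u by (intro mult_mono) (auto simp: abs_le_iff)
  have bb: "\<bar>?g \<omega> * ?b \<omega>\<bar> \<le> K * exp u" for \<omega>
  proof -
    have "exp (u * ?X \<omega>) \<le> exp u" using X[of \<omega>] u by (simp add: mult_left_le)
    moreover have "1 \<le> exp (u * ?X \<omega>)" using X[of \<omega>] u by simp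
    ultimately have "\<bar>?b \<omega>\<bar> \<le> exp u" by linarith
    then show ?thesis unfolding abs_mult using gb[of \<omega>] K0 by (intro mult_mono) auto
  qed
  have aV: "\<bar>?g \<omega> * ?a \<omega> * ?V \<omega>\<bar> \<le> K * 1" for \<omega>
    using ab[of \<omega>] K0 by (auto simp: indicator_def)
  have bV: "\<bar>?g \<omega> * ?b \<omega> * (1 - ?V \<omega>)\<bar> \<le> K * exp u" for \<omega>
    using bb[of \<omega>] K0 by (auto simp: indicator_def)
  have aVm: "(\<lambda>\<omega>. ?g \<omega> * ?a \<omega> * ?V \<omega>) \<in> borel_measurable (info ?K)"
    by (rule borel_measurable_times[OF ga(2) V]) auto
  have bVm: "(\<lambda>\<omega>. ?g \<omega> * ?b \<omega> * (1 - ?V \<omega>)) \<in> borel_measurable (info ?K)"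
    by (rule borel_measurable_times[OF ga(3) borel_measurable_diff[OF borel_measurable_const V]]) auto
  note int_g = integrable_info[OF ga(1)[OF order_refl] hist_subset gb]
  note int_a = integrable_info[OF ga(2)[OF order_refl] hist_subset ab]
  note int_b = integrable_info[OF ga(3)[OF order_refl] hist_subset bb]
  have int_aV: "integrable M (\<lambda>\<omega>. ?g \<omega> * ?a \<omega> * ?V \<omega> * ?A \<omega>)"
    using integrable_real_mult_indicator[OF A_events[of "Suc m"] integrable_info[OF aVm K(1) aV]] by simp
  have int_bV: "integrable M (\<lambda>\<omega>. ?g \<omega> * ?b \<omega> * (1 - ?V \<omega>) * ?B \<omega>)"
    using integrable_real_mult_indicator[OF B_events[of "Suc m"] integrable_info[OF bVm K(1) bV]] by simp
  have int_bV': "integrable M (\<lambda>\<omega>. ?g \<omega> * ?b \<omega> * ?V \<omega>)"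
    by (rule integrable_info[OF borel_measurable_times[OF ga(3) V] K(1), of "K * exp u"])
       (use bb K0 in \<open>auto simp: indicator_def\<close>)
  have int_aX: "integrable M (\<lambda>\<omega>. ?g \<omega> * ?a \<omega> * ?X \<omega>)"
    and int_bX: "integrable M (\<lambda>\<omega>. ?g \<omega> * ?b \<omega> * ?X \<omega>)"
  proof -
    have "\<bar>h * ?X \<omega>\<bar> \<le> \<bar>h\<bar>" for h \<omega> using X[of \<omega>] by (simp add: abs_mult mult_left_le)
    then have "\<bar>?g \<omega> * ?a \<omega> * ?X \<omega>\<bar> \<le> K * 1" "\<bar>?g \<omega> * ?b \<omega> * ?X \<omega>\<bar> \<le> K * exp u" for \<omega>
      using ab[of \<omega>] bb[of \<omega>] by (meson order_trans)+
    then show "integrable M (\<lambda>\<omega>. ?g \<omega> * ?a \<omega> * ?X \<omega>)" "integrable M (\<lambda>\<omega>. ?g \<omega> * ?b \<omega> * ?X \<omega>)"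
      by (auto intro!: integrable_info[OF borel_measurable_times[OF ga(2) bandit_hist] hist_subset]
          integrable_info[OF borel_measurable_times[OF ga(3) bandit_hist] hist_subset])
  qed
  \<comment> \<open>At most one of the two corrections is nonzero, according to the arm
    selected.\<close>
  have split: "f \<omega> * exp (- (l * bandit \<gamma> U A B x (Suc m) \<omega>))
      = ?g \<omega> + ?g \<omega> * ?a \<omega> * ?V \<omega> * ?A \<omega> + ?g \<omega> * ?b \<omega> * (1 - ?V \<omega>) * ?B \<omega>" for \<omega>
  proof (cases "U (Suc m) \<omega> \<le> ?X \<omega>")
    case True
    then show ?thesis
      unfolding bandit_Suc_eq u_def
      by (cases "\<omega> \<in> A (Suc m)") (auto simp: algebra_simps exp_add[symmetric])
  next
    case False
    then show ?thesis
      unfolding bandit_Suc_eq u_def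
      by (cases "\<omega> \<in> B (Suc m)") (auto simp: algebra_simps exp_add[symmetric])
  qed
  have "expectation (\<lambda>\<omega>. f \<omega> * exp (- (l * bandit \<gamma> U A B x (Suc m) \<omega>)))
      = expectation ?g + expectation (\<lambda>\<omega>. ?g \<omega> * ?a \<omega> * ?V \<omega> * ?A \<omega>)
        + expectation (\<lambda>\<omega>. ?g \<omega> * ?b \<omega> * (1 - ?V \<omega>) * ?B \<omega>)"
    unfolding split using int_g int_aV int_bV by simp
  \<comment> \<open>The arm outcome goes first, since \<open>?K\<close> still holds the uniform; the
    uniform is then averaged over the past.\<close>
  also have "expectation (\<lambda>\<omega>. ?g \<omega> * ?a \<omega> * ?V \<omega> * ?A \<omega>) = expectation (\<lambda>\<omega>. ?g \<omega> * ?a \<omega> * ?V \<omega>) * p\<^sub>A"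
    by (rule expectation_arm(1)[OF K(1) _ K(2) aVm aV]) simp
  also have "expectation (\<lambda>\<omega>. ?g \<omega> * ?a \<omega> * ?V \<omega>) = expectation (\<lambda>\<omega>. ?g \<omega> * ?a \<omega> * ?X \<omega>)"
    by (rule expectation_U_threshold[OF hist_subset _ K(3) ga(2) ab bandit_hist]) (use X in auto)
  also have "expectation (\<lambda>\<omega>. ?g \<omega> * ?b \<omega> * (1 - ?V \<omega>) * ?B \<omega>)
      = expectation (\<lambda>\<omega>. ?g \<omega> * ?b \<omega> * (1 - ?V \<omega>)) * p\<^sub>B"
    by (rule expectation_arm(2)[OF K(1) _ K(2) bVm bV]) simp
  \<comment> \<open>The complement is split off because the threshold lemma treats only U \<le>
    X.\<close>
  also have "expectation (\<lambda>\<omega>. ?g \<omega> * ?b \<omega> * (1 - ?V \<omega>))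
      = expectation (\<lambda>\<omega>. ?g \<omega> * ?b \<omega>) - expectation (\<lambda>\<omega>. ?g \<omega> * ?b \<omega> * ?V \<omega>)"
    unfolding right_diff_distrib mult_1_right
    by (rule Bochner_Integration.integral_diff) (use int_b int_bV' in \<open>auto simp: right_diff_distrib\<close>)
  also have "expectation (\<lambda>\<omega>. ?g \<omega> * ?b \<omega> * ?V \<omega>) = expectation (\<lambda>\<omega>. ?g \<omega> * ?b \<omega> * ?X \<omega>)"
    by (rule expectation_U_threshold[OF hist_subset _ K(3) ga(3) bb bandit_hist]) (use X in auto)
  also have "expectation ?g + expectation (\<lambda>\<omega>. ?g \<omega> * ?a \<omega> * ?X \<omega>) * p\<^sub>A
        + (expectation (\<lambda>\<omega>. ?g \<omega> * ?b \<omega>) - expectation (\<lambda>\<omega>. ?g \<omega> * ?b \<omega> * ?X \<omega>)) * p\<^sub>B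
      = expectation (\<lambda>\<omega>. ?g \<omega> + ?g \<omega> * ?a \<omega> * ?X \<omega> * p\<^sub>A
        + (?g \<omega> * ?b \<omega> - ?g \<omega> * ?b \<omega> * ?X \<omega>) * p\<^sub>B)"
  proof -
    have "expectation G + expectation a * p + (expectation b - expectation c) * q
        = expectation (\<lambda>\<omega>. G \<omega> + a \<omega> * p + (b \<omega> - c \<omega>) * q)"
      if "integrable M G" "integrable M a" "integrable M b" "integrable M c"
      for G a b c :: "'w \<Rightarrow> real" and p q
      using that by simp
    from this[OF int_g int_aX int_b int_bX] show ?thesis .
  qed
  also have "\<dots> \<le> expectation (\<lambda>\<omega>. ?g \<omega> * (1 - (p\<^sub>A - p\<^sub>B) / 2 * (l * \<gamma> (Suc m)) * ?X \<omega> * (1 - ?X \<omega>)))"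
  proof (rule integral_mono)
    show "integrable M (\<lambda>\<omega>. ?g \<omega> + ?g \<omega> * ?a \<omega> * ?X \<omega> * p\<^sub>A + (?g \<omega> * ?b \<omega> - ?g \<omega> * ?b \<omega> * ?X \<omega>) * p\<^sub>B)"
      using int_g int_aX int_b int_bX
      by (intro Bochner_Integration.integrable_add Bochner_Integration.integrable_diff integrable_mult_left)
    have XX: "\<bar>?X \<omega> * (1 - ?X \<omega>)\<bar> \<le> 1" for \<omega>
      using X[of \<omega>] by (simp add: abs_mult mult_le_one)
    let ?d = "(p\<^sub>A - p\<^sub>B) / 2 * (l * \<gamma> (Suc m))"
    have "\<bar>?g \<omega> * (1 - ?d * ?X \<omega> * (1 - ?X \<omega>))\<bar> \<le> K * (1 + \<bar>?d\<bar>)" for \<omega>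
    proof -
      have "\<bar>?d * (?X \<omega> * (1 - ?X \<omega>))\<bar> \<le> \<bar>?d\<bar> * 1"
        unfolding abs_mult[of ?d] by (intro mult_left_mono XX) auto
      then have "\<bar>1 - ?d * ?X \<omega> * (1 - ?X \<omega>)\<bar> \<le> 1 + \<bar>?d\<bar>" by (simp only: mult.assoc)
      then show ?thesis unfolding abs_mult[of "?g \<omega>"] using gb[of \<omega>] K0 by (intro mult_mono) auto
    qed
    moreover have "(\<lambda>\<omega>. ?g \<omega> * (1 - ?d * ?X \<omega> * (1 - ?X \<omega>))) \<in> borel_measurable (info (hist m))"
    proof -
      note [measurable] = ga(1)[OF order_refl] meas(2)[OF order_refl]
      show ?thesis by measurable
    qed
    ultimately show "integrable M (\<lambda>\<omega>. ?g \<omega> * (1 - ?d * ?X \<omega> * (1 - ?X \<omega>)))"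
      by (intro integrable_info[OF _ hist_subset])
    fix \<omega>
    have "p\<^sub>A * ?X \<omega> * ?a \<omega> + p\<^sub>B * (1 - ?X \<omega>) * ?b \<omega> \<le> - ((p\<^sub>A - p\<^sub>B) / 2 * u * ?X \<omega> * (1 - ?X \<omega>))"
      by (rule exp_drift_bound[OF X u]) (use p in auto)
    moreover have "0 \<le> ?g \<omega>" using f(2) by simp
    ultimately have "?g \<omega> * (p\<^sub>A * ?X \<omega> * ?a \<omega> + p\<^sub>B * (1 - ?X \<omega>) * ?b \<omega>)
        \<le> ?g \<omega> * - ((p\<^sub>A - p\<^sub>B) / 2 * u * ?X \<omega> * (1 - ?X \<omega>))"
      by (rule mult_left_mono)
    moreover have "G + G * a * X * p\<^sub>A + (G * b - G * b * X) * p\<^sub>B = G + G * (p\<^sub>A * X * a + p\<^sub>B * (1 - X) * b)"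
      "G * (1 - d * X * (1 - X)) = G + G * - (d * X * (1 - X))" for G a b X d :: real
      by (simp_all add: algebra_simps)
    ultimately show "?g \<omega> + ?g \<omega> * ?a \<omega> * ?X \<omega> * p\<^sub>A + (?g \<omega> * ?b \<omega> - ?g \<omega> * ?b \<omega> * ?X \<omega>) * p\<^sub>B
        \<le> ?g \<omega> * (1 - (p\<^sub>A - p\<^sub>B) / 2 * (l * \<gamma> (Suc m)) * ?X \<omega> * (1 - ?X \<omega>))"
      unfolding u_def[symmetric] by (simp only: add_left_mono)
  qed
  finally show ?thesis .
qed

end

section \<open>Decay rates of the random products, and exclusion of a limit 0\<close>

section \<open>Infallibility\<close>

context two_armed_bandit begin

text \<open>\<open>s\<close> selects a coordinate of the arm outcome, so the cases A and B share one
  proof and take independence from \<open>arms_indep\<close>. The centred terms \<gamma> (1_E - p)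
  have second moment at most \<gamma>^2, so their series converges almost surely and
  \<open>exp_times_prod_convergent\<close> applies pathwise.\<close>

lemma AE_exp_times_prod_convergent:
  fixes E :: "nat \<Rightarrow> 'w set" and s :: "real \<times> real \<Rightarrow> real"
  assumes sq: "summable (\<lambda>k. (\<gamma> (Suc k))\<^sup>2)"
    and s: "s \<in> borel_measurable borel" "\<And>n \<omega>. s (arm_outcome A B n \<omega>) = indicator (E n) \<omega>"
    and E: "\<And>n. 1 \<le> n \<Longrightarrow> E n \<in> events" "\<And>n. 1 \<le> n \<Longrightarrow> prob (E n) = p"
  shows "AE \<omega> in M. \<exists>L>0. (\<lambda>n. exp (p * partial_steps \<gamma> n) *
    (\<Prod>k<n. 1 - \<gamma> (Suc k) * indicator (E (Suc k)) \<omega>)) \<longlonglongrightarrow> L"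
proof -
  let ?Y = "\<lambda>k \<omega>. \<gamma> (Suc k) * (indicator (E (Suc k)) \<omega> - p) :: real"
  have Ei: "integrable M (indicator (E (Suc k)) :: 'w \<Rightarrow> real)" for k
    using E(1)[of "Suc k"] by (auto simp: emeasure_eq_measure)
  have p: "0 \<le> p" "p \<le> 1" using E(2)[of 1] prob_le_1[of "E 1"] measure_nonneg[of M "E 1"] by auto
  have Ym: "?Y k \<in> borel_measurable M" for k
    using E(1)[of "Suc k"] by (intro borel_measurable_times borel_measurable_diff) auto
  have Y2: "(?Y k \<omega>)\<^sup>2 \<le> (\<gamma> (Suc k))\<^sup>2" for k \<omega>
  proof -
    have "\<bar>indicator (E (Suc k)) \<omega> - p\<bar> \<le> 1" using p by (auto simp: indicator_def)
    then have "\<bar>?Y k \<omega>\<bar> \<le> \<bar>\<gamma> (Suc k)\<bar> * 1" unfolding abs_mult by (intro mult_left_mono) auto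
    then show ?thesis by (subst abs_le_square_iff[symmetric]) simp
  qed
  have Y2i: "integrable M (\<lambda>\<omega>. (?Y k \<omega>)\<^sup>2)" for k
    by (rule integrable_const_bound[where B="(\<gamma> (Suc k))\<^sup>2"]) (use Y2 Ym in auto)
  have "AE \<omega> in M. summable (\<lambda>k. ?Y k \<omega>)"
  proof (rule Kolmogorov_one_series)
    have arms: "indep_vars (\<lambda>_. borel) (\<lambda>k. arm_outcome A B (Suc k)) UNIV"
      by (rule indep_vars_reindex[OF arms_indep]) auto
    have "indep_vars (\<lambda>_. borel) (\<lambda>k \<omega>. \<gamma> (Suc k) * (s (arm_outcome A B (Suc k) \<omega>) - p)) UNIV"
      by (rule indep_vars_compose2[OF arms, where Y="\<lambda>k z. \<gamma> (Suc k) * (s z - p)"]) (use s(1) in auto)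
    then show "indep_vars (\<lambda>_. borel) ?Y UNIV" unfolding s(2) .
    show "expectation (?Y k) = 0" for k
      using Ei[of k] E[of "Suc k"] by (simp add: prob_space)
    show "summable (\<lambda>k. expectation (\<lambda>\<omega>. (?Y k \<omega>)\<^sup>2))"
    proof (rule summable_comparison_test'[OF sq])
      fix k
      have "expectation (\<lambda>\<omega>. (?Y k \<omega>)\<^sup>2) \<le> expectation (\<lambda>\<omega>. (\<gamma> (Suc k))\<^sup>2)"
        by (rule integral_mono[OF Y2i]) (use Y2 in auto)
      then show "norm (expectation (\<lambda>\<omega>. (?Y k \<omega>)\<^sup>2)) \<le> (\<gamma> (Suc k))\<^sup>2"
        by (simp add: prob_space)
    qed
  qed (rule Y2i)
  then show ?thesis
  proof eventually_elim
    case (elim \<omega>)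
    show ?case unfolding partial_steps_eq_sum
      by (rule exp_times_prod_convergent) (use step_bounds sq elim in \<open>auto simp: indicator_def\<close>)
  qed
qed

lemma
  assumes "summable (\<lambda>k. (\<gamma> (Suc k))\<^sup>2)"
  shows AE_exp_times_prod_A: "AE \<omega> in M. \<exists>L>0. (\<lambda>n. exp (p\<^sub>A * partial_steps \<gamma> n) *
      (\<Prod>k<n. 1 - \<gamma> (Suc k) * indicator (A (Suc k)) \<omega>)) \<longlonglongrightarrow> L"
    and AE_exp_times_prod_B: "AE \<omega> in M. \<exists>L>0. (\<lambda>n. exp (p\<^sub>B * partial_steps \<gamma> n) *
      (\<Prod>k<n. 1 - \<gamma> (Suc k) * indicator (B (Suc k)) \<omega>)) \<longlonglongrightarrow> L"
  by (rule AE_exp_times_prod_convergent[OF assms borel_measurable_continuous_onI[of fst]]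
        AE_exp_times_prod_convergent[OF assms borel_measurable_continuous_onI[of snd]];
      auto intro: continuous_intros A_events B_events prob_arm simp: arm_outcome_def)+

text \<open>From N on \<Gamma> lies in the range where exp (p s) / s increases, and the bound on
  \<gamma> is explicit. The multipliers \<open>l n\<close> below rest on both facts.\<close>

lemma step_condition_bound:
  assumes "0 < p" and O: "\<gamma> \<in> O(\<lambda>n. partial_steps \<gamma> n * exp (- p * partial_steps \<gamma> n))"
  obtains C N where "0 < C" "1 \<le> N" "\<And>n. N \<le> n \<Longrightarrow> 1 / p \<le> partial_steps \<gamma> n"
    "\<And>n. N \<le> n \<Longrightarrow> \<gamma> n \<le> C * (partial_steps \<gamma> n * exp (- p * partial_steps \<gamma> n))"
proof -
  from O obtain C where C: "0 < C"
    and ev: "eventually (\<lambda>n. norm (\<gamma> n) \<le> C * norm (partial_steps \<gamma> n * exp (- p * partial_steps \<gamma> n))) sequentially"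
    by (auto elim!: landau_o.bigE)
  have "eventually (\<lambda>n. 1 / p \<le> partial_steps \<gamma> n) sequentially"
    using steps_diverge by (simp add: filterlim_at_top)
  from eventually_conj[OF ev this] obtain N0 where N0: "\<And>n. N0 \<le> n \<Longrightarrow>
      norm (\<gamma> n) \<le> C * norm (partial_steps \<gamma> n * exp (- p * partial_steps \<gamma> n)) \<and> 1 / p \<le> partial_steps \<gamma> n"
    unfolding eventually_sequentially by auto
  show thesis
  proof (rule that[OF C, of "max N0 1"])
    fix n assume n: "max N0 1 \<le> n"
    then show *: "1 / p \<le> partial_steps \<gamma> n" using N0 by simp
    then have "0 \<le> partial_steps \<gamma> n" using \<open>0 < p\<close> by (meson divide_nonneg_pos order_trans zero_le_one)
    then show "\<gamma> n \<le> C * (partial_steps \<gamma> n * exp (- p * partial_steps \<gamma> n))"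
      using N0[of n] n steps[of n] by (simp add: abs_mult)
  qed simp
qed

theorem AE_not_fall:
  assumes p: "0 < p\<^sub>B" "p\<^sub>B < p\<^sub>A" "p\<^sub>A \<le> 1" and x: "x \<in> {0<..<1}"
    and O: "\<gamma> \<in> O(\<lambda>n. partial_steps \<gamma> n * exp (- p\<^sub>B * partial_steps \<gamma> n))"
  shows "AE \<omega> in M. \<not> (\<lambda>n. bandit \<gamma> U A B x n \<omega>) \<longlonglongrightarrow> 0"
proof -
  obtain C N where C: "0 < C" and N: "1 \<le> N" and \<Gamma>N: "\<And>n. N \<le> n \<Longrightarrow> 1 / p\<^sub>B \<le> partial_steps \<gamma> n"
    and \<gamma>N: "\<And>n. N \<le> n \<Longrightarrow> \<gamma> n \<le> C * (partial_steps \<gamma> n * exp (- p\<^sub>B * partial_steps \<gamma> n))"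
    using step_condition_bound[OF p(1) O] by blast
  let ?X = "\<lambda>n. bandit \<gamma> U A B x n"
  let ?\<Gamma> = "partial_steps \<gamma>"
  define \<delta> where "\<delta> = (p\<^sub>A - p\<^sub>B) / 3"
  define l where "l n = \<delta> / C * (exp (p\<^sub>B * ?\<Gamma> n) / ?\<Gamma> n)" for n
  \<comment> \<open>The relative loss of exp (- l X) granted by the drift bound at step n.\<close>
  define a where "a n \<omega> = (p\<^sub>A - p\<^sub>B) / 2 * (l n * \<gamma> (Suc n)) * ?X n \<omega> * (1 - ?X n \<omega>)" for n \<omega>
  \<comment> \<open>Summation starts at N, where \<open>l\<close> begins to increase and the bound
    on \<gamma> begins to hold.\<close>
  define S where "S n \<omega> = (\<Sum>k\<in>{N..<n}. a k \<omega>)" for n \<omega>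
  have \<delta>: "0 < \<delta>" using p by (simp add: \<delta>_def)
  have X: "0 \<le> ?X n \<omega>" "?X n \<omega> \<le> 1" for n \<omega> using bandit_bounds[OF x] by auto
  have \<Gamma>0: "0 < ?\<Gamma> n" if "N \<le> n" for n
    using \<Gamma>N[OF that] p(1) by (meson divide_pos_pos less_le_trans zero_less_one)
  have \<Gamma>_mono: "?\<Gamma> m \<le> ?\<Gamma> n" if "m \<le> n" for m n
    using partial_steps_mono[of \<gamma> m n] step_bounds(1) that by auto
  have l0: "0 \<le> l n" if "N \<le> n" for n
    using \<Gamma>0[OF that] \<delta> C by (simp add: l_def)
  have l_mono: "l m \<le> l n" if "N \<le> m" "m \<le> n" for m n
    unfolding l_def using \<delta> C that
    by (intro mult_left_mono exp_over_id_mono p(1) \<Gamma>N \<Gamma>_mono) auto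
  have l_\<gamma>: "l n * \<gamma> (Suc m) \<le> \<delta>" if "N \<le> n" "n \<le> m" for n m
  proof -
    \<comment> \<open>As \<open>l\<close> increases, \<open>l n\<close> may be replaced by
      \<open>l (Suc m)\<close>, which cancels the bound on \<gamma> (Suc m) exactly.\<close>
    have "l n * \<gamma> (Suc m) \<le> l (Suc m) * (C * (?\<Gamma> (Suc m) * exp (- p\<^sub>B * ?\<Gamma> (Suc m))))"
      using that l_mono[of n "Suc m"] \<gamma>N[of "Suc m"] l0[of "Suc m"] step_bounds
      by (intro mult_mono) auto
    also have "\<dots> = \<delta>"
      using \<Gamma>0[of "Suc m"] C that unfolding l_def by (simp add: exp_minus field_simps del: partial_steps_Suc)
    finally show ?thesis .
  qed
  have a0: "0 \<le> a n \<omega>" if "N \<le> n" for n \<omega>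
    using l0[OF that] step_bounds(1)[of n] X[of n \<omega>] p by (simp add: a_def)
  have a_bound: "a n \<omega> \<le> 1" if "N \<le> n" for n \<omega>
  proof -
    have d: "0 \<le> l n * \<gamma> (Suc n)" "l n * \<gamma> (Suc n) \<le> 1"
      using l0[OF that] step_bounds(1)[of n] l_\<gamma>[OF that order_refl] p by (auto simp: \<delta>_def)
    have "(p\<^sub>A - p\<^sub>B) / 2 * (l n * \<gamma> (Suc n)) \<le> 1"
      by (rule mult_le_one) (use d p in auto)
    moreover have "0 \<le> ?X n \<omega> * (1 - ?X n \<omega>)" using X[of n \<omega>] by simp
    moreover have "?X n \<omega> * (1 - ?X n \<omega>) \<le> 1" using X[of n \<omega>] by (intro mult_le_one) auto
    ultimately show ?thesis unfolding a_def mult.assoc[of _ "?X n \<omega>"]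
      by (rule mult_le_one)
  qed
  have S0: "0 \<le> S n \<omega>" for n \<omega> unfolding S_def by (intro sum_nonneg a0) auto
  have S_bound: "S n \<omega> \<le> real n" for n \<omega>
  proof -
    have "S n \<omega> \<le> (\<Sum>k\<in>{N..<n}. 1)" unfolding S_def by (intro sum_mono a_bound) auto
    then show ?thesis by simp
  qed
  have am: "a k \<in> borel_measurable (info (hist k))" for k
  proof -
    note [measurable] = bandit_hist[of x k]
    show ?thesis unfolding a_def by measurable
  qed
  \<comment> \<open>\<open>S n\<close> involves only \<open>a k\<close> with k < n, so it is already
    known at time n - 1.\<close>
  have Sm: "S n \<in> borel_measurable (info (hist m))" if "n \<le> Suc m" for n m
    unfolding S_def
    by (intro borel_measurable_sum measurable_family_algebra_mono[OF am] hist_mono) (use that in auto)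
  have Sm': "S n \<in> borel_measurable M" for n
    by (rule info_subalgebra[OF Sm[OF le_SucI[OF order_refl]] hist_subset])
  have intexp: "integrable M (\<lambda>\<omega>. (1 + S n \<omega>) * exp (- (l k * ?X m \<omega>)))" if "N \<le> k" for n k m
  proof (rule integrable_const_bound[where B="1 + real n"])
    show "AE \<omega> in M. norm ((1 + S n \<omega>) * exp (- (l k * ?X m \<omega>))) \<le> 1 + real n"
    proof (rule AE_I2)
      fix \<omega>
      have "(1 + S n \<omega>) * exp (- (l k * ?X m \<omega>)) \<le> (1 + real n) * 1"
        using S0[of n \<omega>] S_bound[of n \<omega>] l0[OF that] X[of m \<omega>] by (intro mult_mono) auto
      then show "norm ((1 + S n \<omega>) * exp (- (l k * ?X m \<omega>))) \<le> 1 + real n" using S0[of n \<omega>] by simp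
    qed
  qed (use Sm' bandit_measurable in measurable)
  have decrease: "expectation (\<lambda>\<omega>. (1 + S j \<omega>) * exp (- (l n * ?X (Suc m) \<omega>)))
      \<le> expectation (\<lambda>\<omega>. (1 + S j \<omega>) * exp (- (l n * ?X m \<omega>)) *
          (1 - (p\<^sub>A - p\<^sub>B) / 2 * (l n * \<gamma> (Suc m)) * ?X m \<omega> * (1 - ?X m \<omega>)))"
    if "N \<le> n" "n \<le> m" "j \<le> Suc m" for j n m
    by (rule expectation_exp_bandit_decrease[OF p x l0[OF that(1)] l_\<gamma>[OF that(1,2), unfolded \<delta>_def],
          where K="1 + real j"])
       (use Sm[OF that(3)] S0 S_bound in \<open>auto intro: borel_measurable_add\<close>)
  \<comment> \<open>Here multiplier and weight advance with time. Raising \<open>l\<close> only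
    lowers the exponential, and the larger weight is paid for by the drift: (1 + S + a) (1 - a)
    \<le> 1 + S.\<close>
  have diagonal_bound: "expectation (\<lambda>\<omega>. (1 + S n \<omega>) * exp (- (l n * ?X n \<omega>))) \<le> 1" if "N \<le> n" for n
    using that
  proof (induction n rule: dec_induct)
    case base
    have "expectation (\<lambda>\<omega>. (1 + S N \<omega>) * exp (- (l N * ?X N \<omega>))) \<le> expectation (\<lambda>\<omega>. 1)"
      by (rule integral_mono[OF intexp[OF order_refl]]) (use l0[of N] X in \<open>auto simp: S_def\<close>)
    then show ?case by (simp add: prob_space)
  next
    case (step n)
    have "expectation (\<lambda>\<omega>. (1 + S (Suc n) \<omega>) * exp (- (l (Suc n) * ?X (Suc n) \<omega>)))
        \<le> expectation (\<lambda>\<omega>. (1 + S (Suc n) \<omega>) * exp (- (l n * ?X (Suc n) \<omega>)))"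
      by (rule integral_mono)
         (use step(1) intexp l_mono[of n "Suc n"] X[of "Suc n"] S0[of "Suc n"]
           in \<open>auto intro!: mult_left_mono mult_right_mono simp del: bandit.simps\<close>)
    also have "\<dots> \<le> expectation (\<lambda>\<omega>. (1 + S (Suc n) \<omega>) * exp (- (l n * ?X n \<omega>)) * (1 - a n \<omega>))"
      using decrease[OF step(1) order_refl order_refl] unfolding a_def .
    also have "\<dots> \<le> expectation (\<lambda>\<omega>. (1 + S n \<omega>) * exp (- (l n * ?X n \<omega>)))"
    proof (rule integral_mono'[OF intexp[OF step(1)]])
      fix \<omega>
      have "(1 + S (Suc n) \<omega>) * (1 - a n \<omega>) \<le> 1 + S n \<omega>"
      proof -
        have "S (Suc n) \<omega> = S n \<omega> + a n \<omega>" using step(1) by (simp add: S_def)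
        then have "(1 + S (Suc n) \<omega>) * (1 - a n \<omega>) = 1 + S n \<omega> - (S n \<omega> * a n \<omega> + a n \<omega> * a n \<omega>)"
          by (simp add: algebra_simps)
        moreover have "0 \<le> S n \<omega> * a n \<omega> + a n \<omega> * a n \<omega>" using S0[of n \<omega>] a0[OF step(1), of \<omega>] by simp
        ultimately show ?thesis by linarith
      qed
      then have "(1 + S (Suc n) \<omega>) * (1 - a n \<omega>) * exp (- (l n * ?X n \<omega>)) \<le> (1 + S n \<omega>) * exp (- (l n * ?X n \<omega>))"
        by (intro mult_right_mono) auto
      then show "(1 + S (Suc n) \<omega>) * exp (- (l n * ?X n \<omega>)) * (1 - a n \<omega>) \<le> (1 + S n \<omega>) * exp (- (l n * ?X n \<omega>))"
        by (simp add: mult_ac)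
      show "0 \<le> (1 + S n \<omega>) * exp (- (l n * ?X n \<omega>))" using S0[of n \<omega>] by simp
    qed
    finally show ?case using step.IH by linarith
  qed
  \<comment> \<open>Now multiplier and weight stay at n while m grows, so only the supermartingale
    property is needed.\<close>
  have weighted_bound: "expectation (\<lambda>\<omega>. (1 + S n \<omega>) * exp (- (l n * ?X m \<omega>))) \<le> 1" if nm: "N \<le> n" "n \<le> m" for n m
    using nm(2)
  proof (induction m rule: dec_induct)
    case base then show ?case by (rule diagonal_bound[OF nm(1)])
  next
    case (step m)
    let ?d = "\<lambda>\<omega>. (p\<^sub>A - p\<^sub>B) / 2 * (l n * \<gamma> (Suc m)) * ?X m \<omega> * (1 - ?X m \<omega>)"
    have d: "0 \<le> ?d \<omega>" "?d \<omega> \<le> 1" for \<omega>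
    proof -
      show "0 \<le> ?d \<omega>" using l0[OF nm(1)] step_bounds(1)[of m] X[of m \<omega>] p by simp
      have Nm: "N \<le> m" using nm(1) step(1) by simp
      have "?d \<omega> \<le> a m \<omega>" unfolding a_def
        using l_mono[OF nm(1) step(1)] step_bounds(1)[of m] X[of m \<omega>] p
        by (intro mult_right_mono mult_left_mono) auto
      then show "?d \<omega> \<le> 1" using a_bound[OF Nm, of \<omega>] by linarith
    qed
    have "expectation (\<lambda>\<omega>. (1 + S n \<omega>) * exp (- (l n * ?X (Suc m) \<omega>)))
        \<le> expectation (\<lambda>\<omega>. (1 + S n \<omega>) * exp (- (l n * ?X m \<omega>)) * (1 - ?d \<omega>))"
      by (rule decrease[OF nm(1) step(1)]) (use step(1) in simp)
    also have "\<dots> \<le> expectation (\<lambda>\<omega>. (1 + S n \<omega>) * exp (- (l n * ?X m \<omega>)))"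
    proof (rule integral_mono'[OF intexp[OF nm(1)]])
      fix \<omega>
      show G: "0 \<le> (1 + S n \<omega>) * exp (- (l n * ?X m \<omega>))" using S0[of n \<omega>] by simp
      show "(1 + S n \<omega>) * exp (- (l n * ?X m \<omega>)) * (1 - ?d \<omega>) \<le> (1 + S n \<omega>) * exp (- (l n * ?X m \<omega>))"
        by (rule mult_left_le) (use d(1)[of \<omega>] G in simp_all)
    qed
    finally show ?case using step.IH by linarith
  qed
  define F where "F = {\<omega> \<in> space M. (\<lambda>n. ?X n \<omega>) \<longlonglongrightarrow> 0}"
  have F [measurable]: "F \<in> events" unfolding F_def by (rule fall_event)
  \<comment> \<open>On F, with n fixed and m growing, the exponential tends to 1, so dominated
    convergence leaves the weight alone.\<close>
  have fall_bound: "expectation (\<lambda>\<omega>. indicator F \<omega> * S n \<omega>) \<le> 1" if n: "N \<le> n" for n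
  proof -
    have "(\<lambda>m. expectation (\<lambda>\<omega>. indicator F \<omega> * ((1 + S n \<omega>) * exp (- (l n * ?X m \<omega>)))))
        \<longlonglongrightarrow> expectation (\<lambda>\<omega>. indicator F \<omega> * ((1 + S n \<omega>) * 1))"
    proof (rule integral_dominated_convergence[where w="\<lambda>_. 1 + real n"])
      show "AE \<omega> in M. (\<lambda>m. indicator F \<omega> * ((1 + S n \<omega>) * exp (- (l n * ?X m \<omega>))))
          \<longlonglongrightarrow> indicator F \<omega> * ((1 + S n \<omega>) * 1)"
      proof (rule AE_I2)
        fix \<omega>
        show "(\<lambda>m. indicator F \<omega> * ((1 + S n \<omega>) * exp (- (l n * ?X m \<omega>)))) \<longlonglongrightarrow> indicator F \<omega> * ((1 + S n \<omega>) * 1)"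
        proof (cases "\<omega> \<in> F")
          case True
          then have "(\<lambda>m. ?X m \<omega>) \<longlonglongrightarrow> 0" by (simp add: F_def)
          then have "(\<lambda>m. exp (- (l n * ?X m \<omega>))) \<longlonglongrightarrow> exp (- (l n * 0))" by (intro tendsto_intros)
          then have "(\<lambda>m. exp (- (l n * ?X m \<omega>))) \<longlonglongrightarrow> 1" by simp
          then show ?thesis by (intro tendsto_intros)
        qed simp
      qed
      show "AE \<omega> in M. norm (indicator F \<omega> * ((1 + S n \<omega>) * exp (- (l n * ?X m \<omega>)))) \<le> 1 + real n" for m
      proof (rule AE_I2)
        fix \<omega>
        have "(1 + S n \<omega>) * exp (- (l n * ?X m \<omega>)) \<le> (1 + real n) * 1"
          using S0[of n \<omega>] S_bound[of n \<omega>] l0[OF n] X[of m \<omega>] by (intro mult_mono) auto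
        then show "norm (indicator F \<omega> * ((1 + S n \<omega>) * exp (- (l n * ?X m \<omega>)))) \<le> 1 + real n"
          using S0[of n \<omega>] by (cases "\<omega> \<in> F") auto
      qed
    qed (use Sm' bandit_measurable in measurable)
    moreover have "expectation (\<lambda>\<omega>. indicator F \<omega> * ((1 + S n \<omega>) * exp (- (l n * ?X m \<omega>)))) \<le> 1" if "n \<le> m" for m
    proof -
      have "expectation (\<lambda>\<omega>. indicator F \<omega> * ((1 + S n \<omega>) * exp (- (l n * ?X m \<omega>))))
          \<le> expectation (\<lambda>\<omega>. (1 + S n \<omega>) * exp (- (l n * ?X m \<omega>)))"
        by (rule integral_mono'[OF intexp[OF n]]) (use S0[of n] in \<open>auto simp: indicator_def\<close>)
      then show ?thesis using weighted_bound[OF n that] by linarith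
    qed
    then have "\<exists>k. \<forall>m\<ge>k. expectation (\<lambda>\<omega>. indicator F \<omega> * ((1 + S n \<omega>) * exp (- (l n * ?X m \<omega>)))) \<le> 1"
      by blast
    ultimately have "expectation (\<lambda>\<omega>. indicator F \<omega> * ((1 + S n \<omega>) * 1)) \<le> 1"
      by (rule LIMSEQ_le_const2)
    moreover have "expectation (\<lambda>\<omega>. indicator F \<omega> * S n \<omega>) \<le> expectation (\<lambda>\<omega>. indicator F \<omega> * ((1 + S n \<omega>) * 1))"
    proof (rule integral_mono)
      show "integrable M (\<lambda>\<omega>. indicator F \<omega> * S n \<omega>)"
        by (rule integrable_const_bound[where B="real n"])
           (use Sm'[of n] S0[of n] S_bound[of n] in \<open>auto simp: indicator_def\<close>)
      show "integrable M (\<lambda>\<omega>. indicator F \<omega> * ((1 + S n \<omega>) * 1))"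
        by (rule integrable_const_bound[where B="1 + real n"])
           (use Sm'[of n] S0[of n] S_bound[of n] in \<open>auto simp: indicator_def\<close>)
    qed (auto simp: indicator_def)
    ultimately show ?thesis by linarith
  qed
  \<comment> \<open>The bound on E[S n; F] is uniform in n, so the drift terms are almost surely
    summable on F.\<close>
  have "AE \<omega> in M. summable (\<lambda>k. indicator F \<omega> * a (k + N) \<omega>)"
  proof (rule AE_summable_of_bounded_expectation)
    show "integrable M (\<lambda>\<omega>. indicator F \<omega> * a (k + N) \<omega>)" for k
      by (rule integrable_const_bound[where B=1])
         (use info_subalgebra[OF am hist_subset, of "k + N"] a0[of "k + N"] a_bound[of "k + N"]
           in \<open>auto simp: indicator_def\<close>)
    show "0 \<le> indicator F \<omega> * a (k + N) \<omega>" for k \<omega> using a0 by simp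
    have "(\<Sum>k<n. a (k + N) \<omega>) = S (N + n) \<omega>" for n \<omega>
      unfolding S_def using sum.shift_bounds_nat_ivl[of "\<lambda>k. a k \<omega>" 0 N n]
      by (simp add: atLeast0LessThan add.commute)
    then show "expectation (\<lambda>\<omega>. \<Sum>k<n. indicator F \<omega> * a (k + N) \<omega>) \<le> 1" for n
      using fall_bound[of "N + n"] by (simp add: sum_distrib_left[symmetric])
  qed
  moreover have "AE \<omega> in M. \<exists>L>0. (\<lambda>n. exp (p\<^sub>B * ?\<Gamma> n) *
      (\<Prod>k<n. 1 - \<gamma> (Suc k) * indicator (B (Suc k)) \<omega>)) \<longlonglongrightarrow> L"
    by (rule AE_exp_times_prod_B[OF summable_step_squares[OF step_bounds(1) p(1) O]])
  ultimately show ?thesis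
    using AE_space
  proof eventually_elim
    case (elim \<omega>)
    show ?case
    proof
      assume lim0: "(\<lambda>n. ?X n \<omega>) \<longlonglongrightarrow> 0"
      then have "\<omega> \<in> F" using elim(3) by (simp add: F_def)
      then have "summable (\<lambda>k. a (k + N) \<omega>)" using elim(1) by simp
      then have sa: "summable (\<lambda>k. a k \<omega>)" by (rule summable_iff_shift[THEN iffD1])
      obtain L where L: "0 < L" and Llim: "(\<lambda>n. exp (p\<^sub>B * ?\<Gamma> n) *
          (\<Prod>k<n. 1 - \<gamma> (Suc k) * indicator (B (Suc k)) \<omega>)) \<longlonglongrightarrow> L" using elim(2) by blast
      \<comment> \<open>The factors come from \<open>a\<close>: eventually exp (p_B \<Gamma>_n) X_n
        \<ge> x L / 2 and 1 - X_n \<ge> 1 / 2.\<close>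
      define c where "c = (p\<^sub>A - p\<^sub>B) / 2 * (\<delta> / C) * (x * (L / 2)) * (1 / 2)"
      have c: "0 < c" using p \<delta> C x L by (simp add: c_def)
      have "eventually (\<lambda>n. L / 2 < exp (p\<^sub>B * ?\<Gamma> n) * (\<Prod>k<n. 1 - \<gamma> (Suc k) * indicator (B (Suc k)) \<omega>)) sequentially"
        by (rule order_tendstoD(1)[OF Llim]) (use L in simp)
      moreover have "eventually (\<lambda>n. ?X n \<omega> < 1 / 2) sequentially"
        by (rule order_tendstoD(2)[OF lim0]) simp
      ultimately have "eventually (\<lambda>n. norm (c * (\<gamma> (Suc n) / ?\<Gamma> n)) \<le> a n \<omega>) sequentially"
        using eventually_ge_at_top[of N]
      proof eventually_elim
        case (elim n)
        let ?P = "\<Prod>k<n. 1 - \<gamma> (Suc k) * indicator (B (Suc k)) \<omega>"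
        have "x * (L / 2) \<le> x * (exp (p\<^sub>B * ?\<Gamma> n) * ?P)"
          using elim(1) x by (intro mult_left_mono) auto
        also have "\<dots> = exp (p\<^sub>B * ?\<Gamma> n) * (x * ?P)" by simp
        also have "\<dots> \<le> exp (p\<^sub>B * ?\<Gamma> n) * ?X n \<omega>"
          by (intro mult_left_mono bandit_ge_prod x) simp
        finally have "x * (L / 2) * (1 / 2) \<le> exp (p\<^sub>B * ?\<Gamma> n) * ?X n \<omega> * (1 - ?X n \<omega>)"
          by (rule mult_mono) (use elim(2) x L X[of n \<omega>] in auto)
        then have "(p\<^sub>A - p\<^sub>B) / 2 * (\<delta> / C) * (\<gamma> (Suc n) / ?\<Gamma> n) * (x * (L / 2) * (1 / 2))
            \<le> (p\<^sub>A - p\<^sub>B) / 2 * (\<delta> / C) * (\<gamma> (Suc n) / ?\<Gamma> n) * (exp (p\<^sub>B * ?\<Gamma> n) * ?X n \<omega> * (1 - ?X n \<omega>))"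
          using p \<delta> C step_bounds(1)[of n] \<Gamma>0[OF elim(3)] by (intro mult_left_mono) auto
        also have "\<dots> = a n \<omega>" by (simp add: a_def l_def mult_ac)
        finally have "c * (\<gamma> (Suc n) / ?\<Gamma> n) \<le> a n \<omega>" by (simp add: c_def mult_ac)
        moreover have "0 \<le> c * (\<gamma> (Suc n) / ?\<Gamma> n)"
          using c step_bounds(1)[of n] \<Gamma>0[OF elim(3)] by simp
        ultimately show ?case by simp
      qed
      from summable_comparison_test_ev[OF this sa]
      have "summable (\<lambda>n. inverse c * (c * (\<gamma> (Suc n) / ?\<Gamma> n)))" by (rule summable_mult)
      then have "summable (\<lambda>n. \<gamma> (Suc n) / ?\<Gamma> n)" using c by (simp add: mult.assoc[symmetric])
      then show False using not_summable_step_ratio[OF step_bounds(2) steps_diverge] by blast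
    qed
  qed
qed

end

section \<open>The path that always selects arm A\<close>

section \<open>The monotone event\<close>

context two_armed_bandit begin

text \<open>The path of the algorithm if every uniform selected A. It is a function of the arm
  outcomes alone, hence independent of the uniforms.\<close>

definition A_run :: "real \<Rightarrow> nat \<Rightarrow> 'w \<Rightarrow> real" where
  "A_run x n \<omega> = 1 - (1 - x) * (\<Prod>k<n. 1 - \<gamma> (Suc k) * indicator (A (Suc k)) \<omega>)"

lemma A_factor_bounds:
  "0 \<le> 1 - \<gamma> (Suc k) * indicator (A (Suc k)) \<omega> \<and> 1 - \<gamma> (Suc k) * indicator (A (Suc k)) \<omega> \<le> 1"
  using step_bounds[of k] by (auto simp: indicator_def)

lemma A_prod_bounds:
  "0 \<le> (\<Prod>k<n. 1 - \<gamma> (Suc k) * indicator (A (Suc k)) \<omega>) \<and> (\<Prod>k<n. 1 - \<gamma> (Suc k) * indicator (A (Suc k)) \<omega>) \<le> 1"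
  using A_factor_bounds by (auto intro!: prod_nonneg prod_le_1)

lemma A_run_bounds:
  assumes "x \<in> {0<..<1}" shows "x \<le> A_run x n \<omega>" "A_run x n \<omega> \<le> 1"
proof -
  have "(1 - x) * (\<Prod>k<n. 1 - \<gamma> (Suc k) * indicator (A (Suc k)) \<omega>) \<le> (1 - x) * 1"
    using assms A_prod_bounds by (intro mult_left_mono) auto
  then show "x \<le> A_run x n \<omega>" by (simp add: A_run_def)
  show "A_run x n \<omega> \<le> 1" using assms A_prod_bounds[of \<omega> n] by (simp add: A_run_def)
qed

lemma A_run_Suc: "A_run x (Suc n) \<omega> = A_run x n \<omega> + \<gamma> (Suc n) * (1 - A_run x n \<omega>) * indicator (A (Suc n)) \<omega>"
  by (simp add: A_run_def algebra_simps)

lemma incseq_A_run: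
  assumes "x \<in> {0<..<1}" shows "incseq (\<lambda>n. A_run x n \<omega>)"
  by (rule incseq_SucI) (use A_run_bounds[OF assms] step_bounds in \<open>simp add: A_run_Suc\<close>)

text \<open>By induction every selection is A. The hypothesis compares the uniforms with
  \<open>A_run\<close> rather than with the process, so that independence gives its
  probability.\<close>

lemma bandit_eq_A_run:
  assumes "\<And>n. U (Suc n) \<omega> \<le> A_run x n \<omega>"
  shows "bandit \<gamma> U A B x n \<omega> = A_run x n \<omega>"
proof (induction n)
  case (Suc n)
  have "bandit \<gamma> U A B x (Suc n) \<omega> = A_run x n \<omega> + \<gamma> (Suc n) * (1 - A_run x n \<omega>) * indicator (A (Suc n)) \<omega>"
    using assms[of n] by (simp add: bandit_Suc_eq Suc mult.assoc del: bandit.simps)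
  then show ?case unfolding A_run_Suc .
qed (simp add: A_run_def)

lemma A_prod_info:
  "(\<lambda>\<omega>. \<Prod>k<n. 1 - \<gamma> (Suc k) * indicator (A (Suc k)) \<omega>) \<in> borel_measurable (info (Inl ` {1..n}))"
  by (intro borel_measurable_prod borel_measurable_diff borel_measurable_const borel_measurable_times A_info) auto

lemma A_run_info: "A_run x n \<in> borel_measurable (info (Inl ` {1..n}))"
proof -
  note [measurable] = A_prod_info[of n]
  show ?thesis unfolding A_run_def by measurable
qed

lemma expectation_A_prod:
  "expectation (\<lambda>\<omega>. \<Prod>k<n. 1 - \<gamma> (Suc k) * indicator (A (Suc k)) \<omega>) = (\<Prod>k<n. 1 - p\<^sub>A * \<gamma> (Suc k))"
proof (induction n)
  case 0
  show ?case by (simp add: prob_space)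
next
  case (Suc n)
  let ?P = "\<lambda>\<omega>. \<Prod>k<n. 1 - \<gamma> (Suc k) * indicator (A (Suc k)) \<omega> :: real"
  have K: "Inl ` {1..n} \<subseteq> noise_index" "Inl (Suc n) \<notin> Inl ` {1..n}" by (auto simp: noise_index_def)
  have b: "\<bar>?P \<omega>\<bar> \<le> 1" for \<omega> using A_prod_bounds[of \<omega> n] by auto
  have Pi: "integrable M ?P" by (rule integrable_info[OF A_prod_info K(1) b])
  have PAi: "integrable M (\<lambda>\<omega>. ?P \<omega> * indicator (A (Suc n)) \<omega>)"
    using integrable_real_mult_indicator[OF A_events[of "Suc n"] Pi] by simp
  have "expectation (\<lambda>\<omega>. \<Prod>k<Suc n. 1 - \<gamma> (Suc k) * indicator (A (Suc k)) \<omega>)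
      = expectation (\<lambda>\<omega>. ?P \<omega> - \<gamma> (Suc n) * (?P \<omega> * indicator (A (Suc n)) \<omega>))"
    by (simp add: algebra_simps)
  also have "\<dots> = expectation ?P - \<gamma> (Suc n) * expectation (\<lambda>\<omega>. ?P \<omega> * indicator (A (Suc n)) \<omega>)"
    using Pi PAi by (subst Bochner_Integration.integral_diff) auto
  also have "expectation (\<lambda>\<omega>. ?P \<omega> * indicator (A (Suc n)) \<omega>) = expectation ?P * p\<^sub>A"
    by (rule expectation_arm(1)[OF K(1) _ K(2) A_prod_info b]) simp
  finally show ?case unfolding Suc by (simp add: algebra_simps)
qed

text \<open>Averaging out the uniform leaves the mean of 1 - \<open>A_run x n\<close>. These
  probabilities are 1 - x times terms of the assumed convergent series.\<close>

lemma prob_U_above_A_run: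
  assumes x: "x \<in> {0<..<1}"
  shows "prob {\<omega>\<in>space M. A_run x n \<omega> < U (Suc n) \<omega>} = (1 - x) * (\<Prod>k<n. 1 - p\<^sub>A * \<gamma> (Suc k))"
proof -
  let ?K = "Inl ` {1..n} :: (nat + nat) set"
  let ?G = "{\<omega>\<in>space M. U (Suc n) \<omega> \<le> A_run x n \<omega>}"
  have K: "?K \<subseteq> noise_index" "Inr (Suc n) \<notin> ?K" by (auto simp: noise_index_def)
  have [measurable]: "U (Suc n) \<in> borel_measurable M" "A_run x n \<in> borel_measurable M"
    using U_measurable[of "Suc n"] info_subalgebra[OF A_run_info K(1)] by auto
  have b: "0 \<le> A_run x n \<omega> \<and> A_run x n \<omega> \<le> 1" for \<omega> using A_run_bounds[OF x, of n \<omega>] x by auto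
  have Pi: "integrable M (\<lambda>\<omega>. \<Prod>k<n. 1 - \<gamma> (Suc k) * indicator (A (Suc k)) \<omega> :: real)"
    by (rule integrable_info[OF A_prod_info K(1), of 1]) (use A_prod_bounds in auto)
  have "prob ?G = expectation (indicator ?G)" by simp
  also have "\<dots> = expectation (\<lambda>\<omega>. 1 * indicator {\<omega>. U (Suc n) \<omega> \<le> A_run x n \<omega>} \<omega>)"
    by (intro Bochner_Integration.integral_cong) (auto simp: indicator_def)
  also have "\<dots> = expectation (\<lambda>\<omega>. 1 * A_run x n \<omega>)"
    by (rule expectation_U_threshold[OF K(1) _ K(2) _ _ A_run_info b, of _ 1]) auto
  also have "\<dots> = 1 - (1 - x) * (\<Prod>k<n. 1 - p\<^sub>A * \<gamma> (Suc k))"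
    unfolding A_run_def expectation_A_prod[symmetric] using Pi by (simp add: prob_space)
  finally have "prob ?G = 1 - (1 - x) * (\<Prod>k<n. 1 - p\<^sub>A * \<gamma> (Suc k))" .
  moreover have "{\<omega>\<in>space M. A_run x n \<omega> < U (Suc n) \<omega>} = space M - ?G" by auto
  ultimately show ?thesis using prob_compl[of ?G] by simp
qed

lemma prob_U_below:
  assumes x: "x \<in> {0<..<1}"
  shows "prob {\<omega>\<in>space M. \<forall>k<n. U (Suc k) \<omega> \<le> x} = x ^ n"
proof (induction n)
  case (Suc n)
  let ?K = "Inr ` {1..n} :: (nat + nat) set"
  let ?G = "\<lambda>n. {\<omega>\<in>space M. \<forall>k<n. U (Suc k) \<omega> \<le> x}"
  have K: "?K \<subseteq> noise_index" "Inr (Suc n) \<notin> ?K" by (auto simp: noise_index_def)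
  have G: "(indicator (?G n) :: 'w \<Rightarrow> real) \<in> borel_measurable (info ?K)"
  proof (rule borel_measurable_indicator)
    have "{\<omega>\<in>space (info ?K). \<forall>k\<in>{..<n}. U (Suc k) \<omega> \<le> x} \<in> sets (info ?K)"
      by (intro sets.sets_Collect_finite_All borel_measurable_le U_info borel_measurable_const) auto
    then show "?G n \<in> sets (info ?K)" by (simp only: space_family_algebra Ball_def lessThan_iff)
  qed
  have ind: "prob H = expectation (indicator H)" if "H \<subseteq> space M" for H
    using that by (simp add: Int_absorb2)
  have "prob (?G (Suc n)) = expectation (indicator (?G (Suc n)))" by (rule ind) auto
  also have "\<dots> = expectation (\<lambda>\<omega>. indicator (?G n) \<omega> * indicator {\<omega>. U (Suc n) \<omega> \<le> x} \<omega>)"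
    by (intro Bochner_Integration.integral_cong) (auto simp: indicator_def less_Suc_eq)
  also have "\<dots> = expectation (\<lambda>\<omega>. indicator (?G n) \<omega> * x)"
    by (rule expectation_U_threshold[OF K(1) _ K(2) G, of 1]) (use x in \<open>auto simp: indicator_def\<close>)
  also have "\<dots> = expectation (indicator (?G n)) * x" by (rule integral_mult_left_zero)
  also have "expectation (indicator (?G n)) = prob (?G n)" by (rule ind[symmetric]) auto
  also have "prob (?G n) * x = x ^ Suc n" unfolding Suc by simp
  finally show ?case .
qed (simp add: prob_space)

text \<open>A union bound controls all times from a suitable N on; before N the event U \<le> x
  suffices because \<open>A_run\<close> never drops below x.\<close>

lemma prob_always_below_A_run:
  assumes x: "x \<in> {0<..<1}" and summ: "summable (\<lambda>n. \<Prod>k<n. 1 - p\<^sub>A * \<gamma> (Suc k))"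
  obtains I where "I \<in> events" "0 < prob I" "\<And>\<omega> n. \<omega> \<in> I \<Longrightarrow> U (Suc n) \<omega> \<le> A_run x n \<omega>"
proof -
  let ?bad = "\<lambda>n. {\<omega>\<in>space M. A_run x n \<omega> < U (Suc n) \<omega>}"
  have Um [measurable]: "U (Suc k) \<in> borel_measurable M" for k by (rule U_measurable) simp
  have Am [measurable]: "A_run x n \<in> borel_measurable M" for n
    by (rule info_subalgebra[OF A_run_info]) (auto simp: noise_index_def)
  have summ': "summable (\<lambda>n. prob (?bad n))"
    unfolding prob_U_above_A_run[OF x] by (rule summable_mult[OF summ])
  obtain N where N: "(\<Sum>n. prob (?bad (n + N))) < 1"
    using order_tendstoD(2)[OF suminf_exist_split2[OF summ'], of 1] by (auto simp: eventually_sequentially)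
  define S where "S = {\<omega>\<in>space M. \<forall>k<N. U (Suc k) \<omega> \<le> x}"
  define G where "G = {\<omega>\<in>space M. \<forall>n. U (Suc (n + N)) \<omega> \<le> A_run x (n + N) \<omega>}"
  \<comment> \<open>The initial event reads uniforms up to index N; the tail event reads arm
    outcomes and uniforms beyond N. Disjoint index sets make the probabilities multiply.\<close>
  let ?K = "Inr ` {1..N} :: (nat + nat) set" and ?L = "Inl ` {1..} \<union> Inr ` {N<..} :: (nat + nat) set"
  have Si: "S \<in> sets (info ?K)"
  proof -
    have "{\<omega>\<in>space (info ?K). \<forall>k\<in>{..<N}. U (Suc k) \<omega> \<le> x} \<in> sets (info ?K)"
      by (intro sets.sets_Collect_finite_All borel_measurable_le U_info borel_measurable_const) auto
    then show ?thesis by (simp only: S_def space_family_algebra Ball_def lessThan_iff)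
  qed
  have Gi: "G \<in> sets (info ?L)"
  proof -
    have "{\<omega>\<in>space (info ?L). \<forall>n. U (Suc (n + N)) \<omega> \<le> A_run x (n + N) \<omega>} \<in> sets (info ?L)"
      by (intro sets.sets_Collect_countable_All borel_measurable_le U_info
          measurable_family_algebra_mono[OF A_run_info]) auto
    then show ?thesis by (simp only: G_def space_family_algebra)
  qed
  have [measurable]: "S \<in> events" "G \<in> events" unfolding S_def G_def
    by measurable
  have "indep_var borel (indicator S :: 'w \<Rightarrow> real) borel (indicator G)"
    by (rule indep_var_family_algebra[OF noise_indep, of ?K ?L])
       (use Si Gi in \<open>auto simp: noise_index_def\<close>)
  then have "expectation (\<lambda>\<omega>. indicator S \<omega> * indicator G \<omega> :: real) = expectation (indicator S) * expectation (indicator G)"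
    by (rule indep_var_lebesgue_integral) (auto simp: emeasure_eq_measure)
  then have SG: "prob (S \<inter> G) = prob S * prob G" by (simp add: indicator_inter_arith[symmetric])
  have "prob (space M - G) \<le> (\<Sum>n. prob (?bad (n + N)))"
  proof -
    have "space M - G = (\<Union>n. ?bad (n + N))" by (auto simp: G_def not_le[symmetric])
    moreover have "prob (\<Union>n. ?bad (n + N)) \<le> (\<Sum>n. prob (?bad (n + N)))"
      by (rule finite_measure_subadditive_countably)
         (use summable_ignore_initial_segment[OF summ'] in auto)
    ultimately show ?thesis by simp
  qed
  then have "0 < prob G" using N prob_compl[of G] by simp
  moreover have "0 < prob S" using prob_U_below[OF x, of N] x by (simp add: S_def)
  ultimately have "0 < prob (S \<inter> G)" unfolding SG by simp
  moreover have "U (Suc n) \<omega> \<le> A_run x n \<omega>" if \<omega>: "\<omega> \<in> S \<inter> G" for \<omega> n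
  proof (cases "n < N")
    case True
    then have "U (Suc n) \<omega> \<le> x" using \<omega> by (auto simp: S_def)
    then show ?thesis using A_run_bounds(1)[OF x, of n \<omega>] by linarith
  next
    case False
    then show ?thesis using \<omega> by (auto simp: G_def dest: spec[of _ "n - N"])
  qed
  ultimately show thesis by (intro that[of "S \<inter> G"]) auto
qed

text \<open>On I the process is \<open>A_run\<close>, so exp (p_A \<Gamma>_n) (1 - X_n) is 1 - x
  times the product treated in \<open>AE_exp_times_prod_A\<close>.\<close>

theorem monotone_convergence_event:
  assumes x: "x \<in> {0<..<1}" and sq: "summable (\<lambda>k. (\<gamma> (Suc k))\<^sup>2)"
    and summ: "summable (\<lambda>n. \<Prod>k<n. 1 - p\<^sub>A * \<gamma> (Suc k))"
  shows "\<exists>I\<in>sets M. measure M I > 0 \<and> (\<forall>\<omega>\<in>I. incseq (\<lambda>n. bandit \<gamma> U A B x n \<omega>)) \<and>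
    (\<exists>\<xi>\<in>borel_measurable M. AE \<omega> in M. \<omega> \<in> I \<longrightarrow> 0 < \<xi> \<omega> \<and>
      (\<lambda>n. exp (p\<^sub>A * partial_steps \<gamma> n) * (1 - bandit \<gamma> U A B x n \<omega>)) \<longlonglongrightarrow> (\<xi> \<omega> :: real))"
proof -
  obtain I where I: "I \<in> events" "0 < prob I" and below: "\<And>\<omega> n. \<omega> \<in> I \<Longrightarrow> U (Suc n) \<omega> \<le> A_run x n \<omega>"
    using prob_always_below_A_run[OF x summ] by blast
  have eq: "bandit \<gamma> U A B x n \<omega> = A_run x n \<omega>" if "\<omega> \<in> I" for n \<omega>
    by (rule bandit_eq_A_run) (rule below[OF that])
  let ?q = "\<lambda>n \<omega>. exp (p\<^sub>A * partial_steps \<gamma> n) * (1 - bandit \<gamma> U A B x n \<omega>)"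
  \<comment> \<open>Using \<open>lim\<close> on the whole space gives measurability; almost surely
    on I the value is (1 - x) L.\<close>
  define \<xi> where "\<xi> \<omega> = lim (\<lambda>n. ?q n \<omega>)" for \<omega>
  have "AE \<omega> in M. \<omega> \<in> I \<longrightarrow> 0 < \<xi> \<omega> \<and> (\<lambda>n. ?q n \<omega>) \<longlonglongrightarrow> \<xi> \<omega>"
    using AE_exp_times_prod_A[OF sq]
  proof eventually_elim
    case (elim \<omega>)
    then obtain L where L: "0 < L" and lim: "(\<lambda>n. exp (p\<^sub>A * partial_steps \<gamma> n) *
      (\<Prod>k<n. 1 - \<gamma> (Suc k) * indicator (A (Suc k)) \<omega>)) \<longlonglongrightarrow> L" by blast
    show ?case
    proof
      assume \<omega>: "\<omega> \<in> I"
      have "(\<lambda>n. (1 - x) * (exp (p\<^sub>A * partial_steps \<gamma> n) *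
          (\<Prod>k<n. 1 - \<gamma> (Suc k) * indicator (A (Suc k)) \<omega>))) \<longlonglongrightarrow> (1 - x) * L"
        by (rule tendsto_mult_left[OF lim])
      moreover have "(1 - x) * (exp (p\<^sub>A * partial_steps \<gamma> n) *
          (\<Prod>k<n. 1 - \<gamma> (Suc k) * indicator (A (Suc k)) \<omega>)) = ?q n \<omega>" for n
        unfolding eq[OF \<omega>] A_run_def by simp
      ultimately have q: "(\<lambda>n. ?q n \<omega>) \<longlonglongrightarrow> (1 - x) * L" by simp
      then have "\<xi> \<omega> = (1 - x) * L" unfolding \<xi>_def by (rule limI)
      then show "0 < \<xi> \<omega> \<and> (\<lambda>n. ?q n \<omega>) \<longlonglongrightarrow> \<xi> \<omega>" using q L x by simp
    qed
  qed
  moreover have "\<xi> \<in> borel_measurable M"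
  proof -
    note [measurable] = bandit_measurable
    show ?thesis unfolding \<xi>_def by measurable
  qed
  moreover have "incseq (\<lambda>n. bandit \<gamma> U A B x n \<omega>)" if "\<omega> \<in> I" for \<omega>
    unfolding eq[OF that] by (rule incseq_A_run[OF x])
  ultimately show ?thesis using I by blast
qed

end

section \<open>Assembly of infallibility, the monotone event and the harmonic example\<close>

theorem proposition8:
  fixes M :: "'w measure"
    and U :: "nat \<Rightarrow> 'w \<Rightarrow> real"
    and A B :: "nat \<Rightarrow> 'w set"
    and p\<^sub>A p\<^sub>B :: real
    and \<gamma> :: "nat \<Rightarrow> real"
  assumes "0 < p\<^sub>B" and "p\<^sub>B < p\<^sub>A" and "p\<^sub>A \<le> 1"
  shows "(two_armed_bandit M U A B p\<^sub>A p\<^sub>B \<gamma> \<and> step_condition p\<^sub>A p\<^sub>B \<gamma> \<longrightarrow>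
      infallible M U A B \<gamma> \<and>
      (\<forall>x\<in>{0<..<1}. \<exists>I\<in>sets M. measure M I > 0 \<and>
        (\<forall>\<omega>\<in>I. incseq (\<lambda>n. bandit \<gamma> U A B x n \<omega>)) \<and>
        (\<exists>\<xi>\<in>borel_measurable M. AE \<omega> in M. \<omega> \<in> I \<longrightarrow>
          0 < \<xi> \<omega> \<and>
          (\<lambda>n. exp (p\<^sub>A * partial_steps \<gamma> n) * (1 - bandit \<gamma> U A B x n \<omega>))
            \<longlonglongrightarrow> (\<xi> \<omega> :: real)))) \<and>
    (\<forall>C::real. 1 / p\<^sub>A < C \<and> C \<le> 1 / p\<^sub>B \<longrightarrow>
      step_condition p\<^sub>A p\<^sub>B (\<lambda>n. C / (C + real n)))"
proof (intro conjI impI allI)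
  fix C assume "1 / p\<^sub>A < C \<and> C \<le> 1 / p\<^sub>B"
  then show "step_condition p\<^sub>A p\<^sub>B (\<lambda>n. C / (C + real n))"
    using step_condition_harmonic[OF assms] by blast
next
  assume h: "two_armed_bandit M U A B p\<^sub>A p\<^sub>B \<gamma> \<and> step_condition p\<^sub>A p\<^sub>B \<gamma>"
  then interpret two_armed_bandit M U A B p\<^sub>A p\<^sub>B \<gamma> by blast
  have O: "\<gamma> \<in> O(\<lambda>n. partial_steps \<gamma> n * exp (- p\<^sub>B * partial_steps \<gamma> n))"
    and summ: "summable (\<lambda>n. \<Prod>k=1..Suc n. 1 - p\<^sub>A * \<gamma> k)"
    using h unfolding step_condition_def by blast+
  show "infallible M U A B \<gamma>"
    unfolding infallible_def
  proof
    fix x :: real assume "x \<in> {0<..<1}"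
    from AE_not_fall[OF assms this O]
    have "{\<omega> \<in> space M. (\<lambda>n. bandit \<gamma> U A B x n \<omega>) \<longlonglongrightarrow> 0} \<in> null_sets M"
      by (subst (asm) AE_iff_null) (use fall_event in auto)
    then show "prob {\<omega> \<in> space M. (\<lambda>n. bandit \<gamma> U A B x n \<omega>) \<longlonglongrightarrow> 0} = 0"
      by (simp add: null_sets_def measure_def)
  qed
  \<comment> \<open>The step condition multiplies over 1, ..., n + 1. After the index shift, adding
    the empty product as first term preserves summability.\<close>
  have "(\<Prod>k=1..Suc n. 1 - p\<^sub>A * \<gamma> k) = (\<Prod>k<Suc n. 1 - p\<^sub>A * \<gamma> (Suc k))" for n
    unfolding One_nat_def by (rule prod.atLeast1_atMost_eq)
  then have "summable (\<lambda>n. \<Prod>k<Suc n. 1 - p\<^sub>A * \<gamma> (Suc k))" using summ by (simp only:)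
  then have "summable (\<lambda>n. \<Prod>k<n. 1 - p\<^sub>A * \<gamma> (Suc k))" by (rule summable_Suc_iff[THEN iffD1])
  then show "\<forall>x\<in>{0<..<1}. \<exists>I\<in>sets M. measure M I > 0 \<and>
        (\<forall>\<omega>\<in>I. incseq (\<lambda>n. bandit \<gamma> U A B x n \<omega>)) \<and>
        (\<exists>\<xi>\<in>borel_measurable M. AE \<omega> in M. \<omega> \<in> I \<longrightarrow>
          0 < \<xi> \<omega> \<and>
          (\<lambda>n. exp (p\<^sub>A * partial_steps \<gamma> n) * (1 - bandit \<gamma> U A B x n \<omega>))
            \<longlonglongrightarrow> (\<xi> \<omega> :: real))"
    using monotone_convergence_event[OF _ summable_step_squares[OF step_bounds(1) assms(1) O]] by blast
qed

end
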